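(* Let $\Theta=\prod_{i=1}^m\theta_i$, where each $\theta_i=\tilde p_i/p_i$ is a rational inner function of degree $(1,1)$ with $p_i(z)=a_i+b_iz_1+c_iz_2+d_iz_1z_2$ having a zero at $\tau_i=(\tau_{1,i},\tau_{2,i})\in\mathbb{T}^2$. Let $\lambda_i$ satisfy $\lambda_i^2=\bar a_ic_i-d_i\bar b_i$, let $f_i(z)=\frac{\lambda_i(z_2-\tau_{2,i})}{p_i(z)}$, let $\mathcal{S}_2$ be the subspace defined below, and let $M_\Theta$ be the $m\times m$ matrix function defined below from the orthonormal basis $e_j=\big(\prod_{k=1}^{j-1}\theta_k\big)f_j$, $j=1,\dots,m$, of $\mathcal{S}_2\ominus z_2\mathcal{S}_2$. Then $M_\Theta$ is given entrywise by \[M_\Theta(z_2)_{ji}=\begin{cases}\overline{\lambda_j\Big(\frac{z_2-\tau_{2,j}}{a_j+c_jz_2}\Big)\lambda_i\Big(\frac{z_2-\tau_{2,i}}{a_i+c_iz_2}\Big)\prod_{k=i+1}^{j-1}\Big(\frac{\bar b_kz_2+\bar d_k}{a_k+c_kz_2}\Big)} & \text{if } j>i,\\[2mm] \overline{\Big(-\frac{b_i+d_iz_2}{a_i+c_iz_2}\Big)} & \text{if } j=i,\\[2mm] 0 & \text{if } j<i.\end{cases}\]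
   Context: $\mathbb{D}$ is the open unit disk, $\mathbb{T}$ the unit circle, $H^2(\mathbb{D}^2)$ the Hardy space of the bidisk. A rational inner function of degree $(1,1)$ can be written $\theta=\tilde p/p$ with $p(z)=a+bz_1+cz_2+dz_1z_2$ having no zeros on $\mathbb{D}^2$ and $\tilde p(z)=\bar az_1z_2+\bar bz_2+\bar cz_1+\bar d$. For inner $\phi$, $\mathcal{K}_\phi=H^2(\mathbb{D}^2)\ominus\phi H^2(\mathbb{D}^2)$. For each $i$ let $\mathcal{S}_{2,\theta_i}=\mathcal{H}\big(f_i(z)\overline{f_i(w)}/(1-z_2\bar w_2)\big)$ (reproducing kernel Hilbert space), and $\mathcal{S}_2=\bigoplus_{i=1}^m\big(\prod_{k=1}^{i-1}\theta_k\big)\mathcal{S}_{2,\theta_i}$; this is a $z_2$-invariant subspace of $\mathcal{K}_\Theta$ whose orthogonal complement in $\mathcal{K}_\Theta$ is $z_1$-invariant, and $\{e_1,\dots,e_m\}$ is an orthonormal basis of $\mathcal{S}_2\ominus z_2\mathcal{S}_2$. There are unique functions $h_{ij}$ in the one-variable Hardy space $H^2_2(\mathbb{D})$ of $z_2$ with $M_{z_1}^*e_j=\sum_{i=1}^m e_ih_{ij}$ for $j=1,\dots,m$ ($M_{z_1}^*$ the adjoint of multiplication by $z_1$ on $H^2(\mathbb{D}^2)$); $M_\Theta$ is defined by $M_\Theta(z_2)_{ji}=\overline{h_{ij}(z_2)}$, i.e. $M_\Theta=H^*$ with $H=(h_{ij})$. With the unitary $\mathcal{U}(g_1,\dots,g_m)=\sum_i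 e_ig_i$ one has $P_{\mathcal{S}_2}M_{z_1}|_{\mathcal{S}_2}=\mathcal{U}T_{M_\Theta}\mathcal{U}^*$, $T_F$ denoting the matrix-valued Toeplitz operator with symbol $F$. Empty products equal $1$. *)

theory Defs
  imports "HOL-Analysis.Analysis"
begin

definition bidisk :: "(complex \<times> complex) set" where
  "bidisk = {z. norm (fst z) < 1 \<and> norm (snd z) < 1}"

definition has_H2_coeffs :: "(complex \<times> complex \<Rightarrow> complex) \<Rightarrow> (nat \<times> nat \<Rightarrow> complex) \<Rightarrow> bool" where
  "has_H2_coeffs f c \<longleftrightarrow>
     (\<lambda>k. (norm (c k))\<^sup>2) summable_on UNIV \<and>
     (\<forall>z\<in>bidisk. ((\<lambda>(m,n). c (m,n) * fst z ^ m * snd z ^ n) has_sum f z) UNIV)"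

definition H2 :: "(complex \<times> complex \<Rightarrow> complex) set" where
  "H2 = {f. \<exists>c. has_H2_coeffs f c}"

definition h2_coeff :: "(complex \<times> complex \<Rightarrow> complex) \<Rightarrow> nat \<times> nat \<Rightarrow> complex" where
  "h2_coeff f = (SOME c. has_H2_coeffs f c)"

definition h2_inner :: "(complex \<times> complex \<Rightarrow> complex) \<Rightarrow> (complex \<times> complex \<Rightarrow> complex) \<Rightarrow> complex" where
  "h2_inner f g = (\<Sum>\<^sub>\<infinity>k. h2_coeff f k * cnj (h2_coeff g k))"

text \<open>One-variable Hardy space H^2 of the disc (in the variable z2); functions are
  normalised to vanish off the open disc so that they are determined by their values on it.\<close>
definition H2_disc :: "(complex \<Rightarrow> complex) set" where
  "H2_disc = {g. (\<exists>c. summable (\<lambda>n. (norm (c n))\<^sup>2) \<and>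
                      (\<forall>w. norm w < 1 \<longrightarrow> (\<lambda>n. c n * w ^ n) sums g w))
               \<and> (\<forall>w. norm w \<ge> 1 \<longrightarrow> g w = 0)}"

definition Mz1_adjoint_is :: "(complex \<times> complex \<Rightarrow> complex) \<Rightarrow> (complex \<times> complex \<Rightarrow> complex) \<Rightarrow> bool" where
  "Mz1_adjoint_is g h \<longleftrightarrow> g \<in> H2 \<and> h \<in> H2 \<and>
     (\<forall>f\<in>H2. h2_inner (\<lambda>z. fst z * f z) g = h2_inner f h)"

definition MTheta_h :: "nat \<Rightarrow> (nat \<Rightarrow> complex \<times> complex \<Rightarrow> complex) \<Rightarrow> nat \<Rightarrow> nat \<Rightarrow> complex \<Rightarrow> complex" where
  "MTheta_h m e = (THE H. (\<forall>i j. H i j \<in> H2_disc) \<and>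
      (\<forall>i j. i \<notin> {1..m} \<or> j \<notin> {1..m} \<longrightarrow> H i j = (\<lambda>_. 0)) \<and>
      (\<forall>j\<in>{1..m}. Mz1_adjoint_is (e j) (\<lambda>z. \<Sum>i=1..m. e i z * H i j (snd z))))"

definition MTheta :: "nat \<Rightarrow> (nat \<Rightarrow> complex \<times> complex \<Rightarrow> complex) \<Rightarrow> complex \<Rightarrow> nat \<Rightarrow> nat \<Rightarrow> complex" where
  "MTheta m e z2 j i = cnj (MTheta_h m e i j z2)"

definition poly11 :: "complex \<Rightarrow> complex \<Rightarrow> complex \<Rightarrow> complex \<Rightarrow> complex \<times> complex \<Rightarrow> complex" where
  "poly11 a b c d z = a + b * fst z + c * snd z + d * fst z * snd z"

definition poly11_refl :: "complex \<Rightarrow> complex \<Rightarrow> complex \<Rightarrow> complex \<Rightarrow> complex \<times> complex \<Rightarrow> complex" where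
  "poly11_refl a b c d z = cnj a * fst z * snd z + cnj b * snd z + cnj c * fst z + cnj d"

definition bipoly_eval :: "nat \<Rightarrow> nat \<Rightarrow> (nat \<Rightarrow> nat \<Rightarrow> complex) \<Rightarrow> complex \<times> complex \<Rightarrow> complex" where
  "bipoly_eval n1 n2 P z = (\<Sum>i\<le>n1. \<Sum>j\<le>n2. P i j * fst z ^ i * snd z ^ j)"

definition rat_bideg_le :: "nat \<Rightarrow> nat \<Rightarrow> (complex \<times> complex \<Rightarrow> complex) \<Rightarrow> bool" where
  "rat_bideg_le n1 n2 g \<longleftrightarrow> (\<exists>P Q. \<forall>z\<in>bidisk.
      bipoly_eval n1 n2 Q z \<noteq> 0 \<and> g z = bipoly_eval n1 n2 P z / bipoly_eval n1 n2 Q z)"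

definition rat_deg_11 :: "(complex \<times> complex \<Rightarrow> complex) \<Rightarrow> bool" where
  "rat_deg_11 g \<longleftrightarrow> rat_bideg_le 1 1 g \<and> \<not> rat_bideg_le 0 1 g \<and> \<not> rat_bideg_le 1 0 g"

end

theory Submission
  imports Defs "HOL-Complex_Analysis.Complex_Analysis"
begin

text \<open>
  \<^emph>\<open>Idea.\<close> The adjoint of multiplication by \<open>z\<^sub>1\<close> is the backward shift in \<open>z\<^sub>1\<close>, that is
  \<open>F \<mapsto> (F(z\<^sub>1,z\<^sub>2) - F(0,z\<^sub>2)) / z\<^sub>1\<close>. A zero of \<open>p\<close> on the torus forces
  \<open>z\<^sub>2 (\<bar>a + c z\<^sub>2\<bar>\<^sup>2 - \<bar>b + d z\<^sub>2\<bar>\<^sup>2) = \<lambda>\<^sup>2 (z\<^sub>2 - \<tau>\<^sub>2)\<^sup>2\<close> on the unit circle, because the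
  left hand side, divided by \<open>z\<^sub>2\<close>, is nonnegative there and vanishes at \<open>\<tau>\<^sub>2\<close>. Hence the backward
  shift maps \<open>\<theta>\<close> to a multiple of \<open>f\<close> by a function of \<open>z\<^sub>2\<close>, and likewise \<open>f\<close>; telescoping over
  the product gives \<open>h\<^sub>i\<^sub>j\<close>.
  The \<open>h\<^sub>i\<^sub>j\<close> are unique: for \<open>z\<^sub>2\<close> near the circle each \<open>\<theta>\<^sub>i(\<cdot>,z\<^sub>2)\<close> has exactly one zero in the
  disc, and evaluating a vanishing combination of the \<open>e\<^sub>i\<close> there kills the coefficients one after
  the other; the identity theorem extends this to all \<open>z\<^sub>2\<close>.
\<close>

section \<open>Square-summable sequences and linear factors\<close>

definition l2 :: "(nat \<Rightarrow> complex) \<Rightarrow> bool" where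
  "l2 u \<longleftrightarrow> summable (\<lambda>n. (norm (u n))\<^sup>2)"

definition sqnorm :: "(nat \<Rightarrow> complex) \<Rightarrow> real" where
  "sqnorm u = (\<Sum>n. (norm (u n))\<^sup>2)"

text \<open>The values of \<open>g\<close> off the open disc stay free, in contrast to
  \<open>H2_disc\<close>, so rational functions can be inserted as they are.\<close>

definition disc_coeffs :: "(complex \<Rightarrow> complex) \<Rightarrow> (nat \<Rightarrow> complex) \<Rightarrow> bool" where
  "disc_coeffs g u \<longleftrightarrow> l2 u \<and> (\<forall>w. norm w < 1 \<longrightarrow> (\<lambda>n. u n * w ^ n) sums g w)"

lemma sqnorm_nonneg: "l2 u \<Longrightarrow> 0 \<le> sqnorm u"
  unfolding l2_def sqnorm_def by (rule suminf_nonneg) auto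

lemma sum_le_sqnorm: "l2 u \<Longrightarrow> finite F \<Longrightarrow> (\<Sum>n\<in>F. (norm (u n))\<^sup>2) \<le> sqnorm u"
  unfolding l2_def sqnorm_def by (rule sum_le_suminf) auto

lemma l2_bounded_sums:
  assumes "\<And>N. (\<Sum>n<N. (norm (u n))\<^sup>2) \<le> M"
  shows "l2 u" "sqnorm u \<le> M"
proof -
  show s: "l2 u"
    unfolding l2_def by (rule summableI_nonneg_bounded[where x = M]) (simp_all add: assms)
  show "sqnorm u \<le> M"
    unfolding sqnorm_def using s unfolding l2_def by (rule suminf_le_const) (rule assms)
qed

lemma norm_mult_le_squares: "norm (x * y) \<le> (norm x)\<^sup>2 + (norm (y::complex))\<^sup>2"
proof -
  have "0 \<le> (norm x - norm y)\<^sup>2" "0 \<le> norm x * norm y" by auto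
  then show ?thesis
    unfolding norm_mult power2_diff by linarith
qed

text \<open>Comparison with \<open>\<bar>u n\<bar>^2 + \<bar>w\<bar>^(2n)\<close>, the sum of a
  square-summable and a geometric part.\<close>

lemma l2_abs_summable:
  assumes "l2 u" "norm w < 1"
  shows "summable (\<lambda>n. norm (u n * w ^ n))"
proof (rule summable_comparison_test')
  have "summable (\<lambda>n. ((norm w)\<^sup>2) ^ n)"
    using assms(2) by (intro summable_geometric) (simp add: abs_square_less_1)
  then show "summable (\<lambda>n. (norm (u n))\<^sup>2 + ((norm w)\<^sup>2) ^ n)"
    using assms(1) unfolding l2_def by (intro summable_add)
  show "norm (norm (u n * w ^ n)) \<le> (norm (u n))\<^sup>2 + ((norm w)\<^sup>2) ^ n" if "n \<ge> 0" for n
  proof -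
    have "(norm (w ^ n))\<^sup>2 = ((norm w)\<^sup>2) ^ n"
      by (metis norm_power power_mult mult.commute)
    then show ?thesis using norm_mult_le_squares[of "u n" "w ^ n"] by simp
  qed
qed

lemma disc_coeffs_suminf:
  assumes "l2 u"
  shows "disc_coeffs (\<lambda>w. \<Sum>n. u n * w ^ n) u"
  unfolding disc_coeffs_def
  using assms summable_norm_cancel[OF l2_abs_summable[OF assms]] by (simp add: summable_sums)

lemma disc_coeffs_eq:
  assumes "disc_coeffs f u" "disc_coeffs g u" "norm w < 1"
  shows "f w = g w"
  using assms unfolding disc_coeffs_def by (blast intro: sums_unique2)

lemma l2_add:
  assumes "l2 u" "l2 v"
  shows "l2 (\<lambda>n. u n + v n)"
  unfolding l2_def
proof (rule summable_comparison_test')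
  show "summable (\<lambda>n. 2 * (norm (u n))\<^sup>2 + 2 * (norm (v n))\<^sup>2)"
    using assms unfolding l2_def by (intro summable_add summable_mult)
  show "norm ((norm (u n + v n))\<^sup>2) \<le> 2 * (norm (u n))\<^sup>2 + 2 * (norm (v n))\<^sup>2" if "n \<ge> 0" for n
  proof -
    have "(norm (u n + v n))\<^sup>2 \<le> (norm (u n) + norm (v n))\<^sup>2"
      by (intro power_mono norm_triangle_ineq) auto
    also have "\<dots> \<le> 2 * (norm (u n))\<^sup>2 + 2 * (norm (v n))\<^sup>2"
      using zero_le_power2[of "norm (u n) - norm (v n)"] by (simp add: power2_eq_square algebra_simps)
    finally show ?thesis by simp
  qed
qed

lemma l2_cmult: "l2 u \<Longrightarrow> l2 (\<lambda>n. k * u n)"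
  unfolding l2_def by (simp add: norm_mult power_mult_distrib summable_mult)

definition delay :: "(nat \<Rightarrow> complex) \<Rightarrow> nat \<Rightarrow> complex" where
  "delay u n = (case n of 0 \<Rightarrow> 0 | Suc k \<Rightarrow> u k)"

lemma delay_simps [simp]: "delay u 0 = 0" "delay u (Suc k) = u k"
  by (simp_all add: delay_def)

lemma l2_delay: "l2 u \<Longrightarrow> l2 (delay u)"
  unfolding l2_def by (subst summable_Suc_iff[symmetric]) simp

lemma delay_sums:
  assumes "(\<lambda>n. u n * w ^ n) sums s"
  shows "(\<lambda>n. delay u n * w ^ n) sums (w * s)"
proof -
  have "(\<lambda>n. delay u (Suc n) * w ^ Suc n) sums (w * s)"
    using sums_mult[OF assms, of w] by (simp add: mult_ac)
  then show ?thesis by (subst (asm) sums_Suc_iff) simp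
qed

text \<open>\<open>lin \<alpha> \<beta>\<close> is multiplication by \<open>\<alpha> + \<beta> w\<close> on coefficient sequences.\<close>

definition lin :: "complex \<Rightarrow> complex \<Rightarrow> (nat \<Rightarrow> complex) \<Rightarrow> nat \<Rightarrow> complex" where
  "lin \<alpha> \<beta> u n = \<alpha> * u n + \<beta> * delay u n"

lemma disc_coeffs_add:
  assumes "disc_coeffs f u" "disc_coeffs g v"
  shows "disc_coeffs (\<lambda>w. f w + g w) (\<lambda>n. u n + v n)"
  unfolding disc_coeffs_def
proof (intro conjI allI impI)
  show "l2 (\<lambda>n. u n + v n)" using assms by (auto simp: disc_coeffs_def intro: l2_add)
  show "(\<lambda>n. (u n + v n) * w ^ n) sums (f w + g w)" if "norm w < 1" for w
    using assms that sums_add[of "\<lambda>n. u n * w ^ n" "f w" "\<lambda>n. v n * w ^ n" "g w"]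
    by (simp add: disc_coeffs_def ring_distribs)
qed

lemma disc_coeffs_cmult:
  assumes "disc_coeffs f u"
  shows "disc_coeffs (\<lambda>w. k * f w) (\<lambda>n. k * u n)"
  using assms unfolding disc_coeffs_def by (auto simp: mult.assoc intro: l2_cmult sums_mult)

lemma disc_coeffs_lin:
  assumes "disc_coeffs f u"
  shows "disc_coeffs (\<lambda>w. (\<alpha> + \<beta> * w) * f w) (lin \<alpha> \<beta> u)"
proof -
  have "disc_coeffs (\<lambda>w. w * f w) (delay u)"
    using assms unfolding disc_coeffs_def by (auto intro: l2_delay delay_sums)
  from disc_coeffs_add[OF disc_coeffs_cmult[OF assms, of \<alpha>] disc_coeffs_cmult[OF this, of \<beta>]]
  show ?thesis by (simp add: lin_def[abs_def] ring_distribs mult.assoc)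
qed

text \<open>Coefficients of \<open>g w / (a + c * w)\<close>: the recursion solves
  \<open>lin a c v = u\<close> for \<open>v\<close> term by term.\<close>

primrec divlin :: "complex \<Rightarrow> complex \<Rightarrow> (nat \<Rightarrow> complex) \<Rightarrow> nat \<Rightarrow> complex" where
  "divlin a c u 0 = u 0 / a"
| "divlin a c u (Suc n) = (u (Suc n) - c * divlin a c u n) / a"

lemma lin_divlin: "a \<noteq> 0 \<Longrightarrow> lin a c (divlin a c u) = u"
proof
  fix n assume "a \<noteq> 0" then show "lin a c (divlin a c u) n = u n"
    by (cases n) (simp_all add: lin_def)
qed

text \<open>From \<open>a * v n = u n - c * delay v n\<close>, Minkowski's inequality on the first
  \<open>N\<close> terms bounds \<open>\<bar>a\<bar>\<close> times the norm of \<open>v\<close> by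
  the norm of \<open>u\<close> plus \<open>\<bar>c\<bar>\<close> times the norm of \<open>v\<close>.
  The section is finite, so the last term can be absorbed because
  \<open>\<bar>c\<bar> < \<bar>a\<bar>\<close>.\<close>

lemma l2_divlin:
  assumes "norm c < norm a" "l2 u"
  shows "l2 (divlin a c u)"
proof -
  define v where "v = divlin a c u"
  have a: "a \<noteq> 0" using assms(1) by auto
  have "L2_set (\<lambda>n. norm (v n)) {..<N} \<le> sqrt (sqnorm u) / (norm a - norm c)" for N
  proof -
    have uv: "norm a * norm (v n) \<le> norm (u n) + norm c * norm (delay v n)" for n
    proof -
      have "u n = lin a c v n" using lin_divlin[OF a, of c u] by (simp add: v_def)
      then have "a * v n = u n - c * delay v n" by (simp add: lin_def)
      then have "norm (a * v n) \<le> norm (u n) + norm (c * delay v n)"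
        by (metis norm_triangle_ineq4)
      then show ?thesis by (simp add: norm_mult)
    qed
    have "L2_set (\<lambda>n. norm (delay v n)) {..<N} \<le> L2_set (\<lambda>n. norm (v n)) {..<N}"
    proof (cases N)
      case (Suc M)
      have "(\<Sum>n<N. (norm (delay v n))\<^sup>2) = (\<Sum>n<M. (norm (v n))\<^sup>2)"
        by (simp add: Suc sum.lessThan_Suc_shift del: sum.lessThan_Suc)
      also have "\<dots> \<le> (\<Sum>n<N. (norm (v n))\<^sup>2)" by (simp add: Suc)
      finally show ?thesis by (simp add: L2_set_def)
    qed simp
    moreover have "L2_set (\<lambda>n. norm a * norm (v n)) {..<N} \<le>
        L2_set (\<lambda>n. norm (u n) + norm c * norm (delay v n)) {..<N}"
      by (intro L2_set_mono uv) auto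
    moreover have "\<dots> \<le> L2_set (\<lambda>n. norm (u n)) {..<N} + L2_set (\<lambda>n. norm c * norm (delay v n)) {..<N}"
      by (rule L2_set_triangle_ineq)
    moreover have "L2_set (\<lambda>n. norm (u n)) {..<N} \<le> sqrt (sqnorm u)"
      unfolding L2_set_def using sum_le_sqnorm[OF assms(2), of "{..<N}"] by simp
    ultimately have "norm a * L2_set (\<lambda>n. norm (v n)) {..<N} \<le>
        sqrt (sqnorm u) + norm c * L2_set (\<lambda>n. norm (v n)) {..<N}"
      by (simp add: L2_set_right_distrib[symmetric])
         (smt (verit, ccfv_SIG) mult_left_mono norm_ge_zero)
    then show ?thesis using assms(1) by (simp add: field_simps)
  qed
  then have "(L2_set (\<lambda>n. norm (v n)) {..<N})\<^sup>2 \<le> (sqrt (sqnorm u) / (norm a - norm c))\<^sup>2" for N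
    by (intro power_mono) (auto simp: L2_set_nonneg)
  then have "(\<Sum>n<N. (norm (v n))\<^sup>2) \<le> (sqrt (sqnorm u) / (norm a - norm c))\<^sup>2" for N
    by (simp add: L2_set_def sum_nonneg)
  from l2_bounded_sums(1)[OF this] show ?thesis by (simp add: v_def)
qed

lemma linear_nonzero_on_disc:
  assumes "norm c < norm a" "norm w \<le> 1"
  shows "a + c * w \<noteq> (0::complex)"
proof
  assume "a + c * w = 0"
  then have "norm a = norm c * norm w"
    by (metis add.commute add_eq_0_iff norm_minus_cancel norm_mult)
  also have "\<dots> \<le> norm c" using assms(2) by (simp add: mult_left_le)
  finally show False using assms(1) by simp
qed

lemma disc_coeffs_divlin:
  assumes "norm c < norm a" "disc_coeffs g u"
  shows "disc_coeffs (\<lambda>w. g w / (a + c * w)) (divlin a c u)"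
proof -
  define v where "v = divlin a c u"
  define h where "h = (\<lambda>w. \<Sum>n. v n * w ^ n)"
  have a: "a \<noteq> 0" using assms(1) by auto
  have v: "disc_coeffs h v"
    unfolding v_def h_def using assms
    by (intro disc_coeffs_suminf l2_divlin) (auto simp: disc_coeffs_def)
  have "disc_coeffs (\<lambda>w. (a + c * w) * h w) u"
    using disc_coeffs_lin[OF v, of a c] lin_divlin[OF a] by (simp add: v_def)
  then have "h w = g w / (a + c * w)" if "norm w < 1" for w
    using disc_coeffs_eq[OF _ assms(2) that] linear_nonzero_on_disc[OF assms(1), of w] that
    by (metis less_imp_le nonzero_mult_div_cancel_left)
  then show ?thesis using v unfolding disc_coeffs_def v_def by auto
qed

lemma disc_coeffs_one: "disc_coeffs (\<lambda>w. 1) (\<lambda>n. if n = 0 then 1 else 0)"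
  unfolding disc_coeffs_def l2_def
  using powser_sums_if[of 0] by (auto intro!: summable_finite[of "{0}"] split: if_splits)

lemma H2_disc_holomorphic: "g \<in> H2_disc \<Longrightarrow> g holomorphic_on ball 0 1"
proof -
  assume "g \<in> H2_disc"
  then obtain u where "\<And>w. norm w < 1 \<Longrightarrow> (\<lambda>n. u n * w ^ n) sums g w"
    by (auto simp: H2_disc_def)
  then show ?thesis by (intro power_series_holomorphic[of _ _ u]) simp
qed

section \<open>Energy conservation for a pair of coefficient sequences\<close>

text \<open>Expanding the squares, the terms in \<open>u1\<close>, \<open>v1\<close> alone form
  \<open>K u1 v1\<close>. By \<open>h2\<close> those in \<open>u0\<close>, \<open>v0\<close> form
  \<open>- K u0 v0\<close>, and \<open>h1\<close> cancels the products of old and new terms. Here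
  \<open>u0\<close>, \<open>v0\<close> stand for the coefficients preceding \<open>u1\<close>,
  \<open>v1\<close>.\<close>

lemma rotation_telescope:
  fixes a b c d l :: complex
  assumes h1: "cnj a * c - d * cnj b = l\<^sup>2"
    and h2: "(norm a)\<^sup>2 + (norm c)\<^sup>2 - (norm b)\<^sup>2 - (norm d)\<^sup>2 = 2 * (norm l)\<^sup>2"
  defines "K \<equiv> \<lambda>u v. ((norm b)\<^sup>2 + (norm l)\<^sup>2 - (norm a)\<^sup>2) * (norm u)\<^sup>2
      + ((norm l)\<^sup>2 + (norm d)\<^sup>2 - (norm a)\<^sup>2) * (norm v)\<^sup>2 + 2 * Re ((d * cnj l - b * l) * u * cnj v)"
  shows "(norm ((- b * u1 + - d * u0) + (cnj l * v1 + l * v0)))\<^sup>2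
     + (norm ((cnj l * u1 + l * u0) + (cnj d * v1 + cnj b * v0)))\<^sup>2
     - (norm (a * u1 + c * u0))\<^sup>2 - (norm (a * v1 + c * v0))\<^sup>2 = K u1 v1 - K u0 v0"
proof -
  have n: "complex_of_real ((norm z)\<^sup>2) = z * cnj z" for z
    by (rule complex_norm_square)
  have re: "complex_of_real (2 * Re z) = z + cnj z" for z
    by (simp add: complex_add_cnj)
  have h1': "a * cnj c - cnj d * b = (cnj l)\<^sup>2"
    using arg_cong[OF h1, of cnj] by simp
  have h2': "a * cnj a + c * cnj c - b * cnj b - d * cnj d = 2 * (l * cnj l)"
    using arg_cong[OF h2, of complex_of_real] by (simp only: of_real_diff of_real_add of_real_mult n of_real_numeral)
  \<comment> \<open>Each of the three brackets on the right is zero: the first two by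
    \<open>h1\<close> and its conjugate, the third by \<open>h2\<close>.\<close>
  have "complex_of_real ((norm ((- b * u1 + - d * u0) + (cnj l * v1 + l * v0)))\<^sup>2
     + (norm ((cnj l * u1 + l * u0) + (cnj d * v1 + cnj b * v0)))\<^sup>2
     - (norm (a * u1 + c * u0))\<^sup>2 - (norm (a * v1 + c * v0))\<^sup>2 - (K u1 v1 - K u0 v0))
     = (u1 * cnj u0 + v1 * cnj v0) * (b * cnj d + (cnj l)\<^sup>2 - a * cnj c)
     + (u0 * cnj u1 + v0 * cnj v1) * (d * cnj b + l\<^sup>2 - cnj a * c)
     + (u0 * cnj u0 + v0 * cnj v0) * (b * cnj b + d * cnj d + 2 * (l * cnj l) - a * cnj a - c * cnj c)"
    unfolding K_def of_real_add of_real_diff re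
    unfolding of_real_add of_real_diff of_real_mult n complex_cnj_add complex_cnj_mult
      complex_cnj_minus complex_cnj_cnj complex_cnj_diff
    by algebra
  also have "\<dots> = 0"
    by (simp add: h1[symmetric] h1'[symmetric] h2'[symmetric])
  finally show ?thesis
    unfolding of_real_eq_0_iff by simp
qed

lemma l2_tendsto_0: "l2 u \<Longrightarrow> u \<longlonglongrightarrow> 0"
  unfolding l2_def by (drule summable_LIMSEQ_zero) (simp add: tendsto_norm_zero_iff)

lemma l2_lin: "l2 u \<Longrightarrow> l2 (lin \<alpha> \<beta> u)"
  unfolding lin_def[abs_def] by (intro l2_add l2_cmult l2_delay)

text \<open>Coefficient form of the fact that the symmetric matrix with rows
  \<open>(- b - d w, cnj l + l w)\<close> and \<open>(cnj l + l w, cnj d + cnj b w)\<close> is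
  \<open>a + c w\<close> times a unitary on the unit circle. The energy differences telescope, so no
  boundary values enter.\<close>

lemma rotation_isometric:
  fixes a b c d l :: complex
  assumes h1: "cnj a * c - d * cnj b = l\<^sup>2"
    and h2: "(norm a)\<^sup>2 + (norm c)\<^sup>2 - (norm b)\<^sup>2 - (norm d)\<^sup>2 = 2 * (norm l)\<^sup>2"
    and u: "l2 u" and v: "l2 v"
  shows "sqnorm (\<lambda>n. lin (- b) (- d) u n + lin (cnj l) l v n)
       + sqnorm (\<lambda>n. lin (cnj l) l u n + lin (cnj d) (cnj b) v n)
       = sqnorm (lin a c u) + sqnorm (lin a c v)"
proof -
  define K where "K = (\<lambda>u v. ((norm b)\<^sup>2 + (norm l)\<^sup>2 - (norm a)\<^sup>2) * (norm u)\<^sup>2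
      + ((norm l)\<^sup>2 + (norm d)\<^sup>2 - (norm a)\<^sup>2) * (norm v)\<^sup>2 + 2 * Re ((d * cnj l - b * l) * u * cnj v))"
  let ?D = "\<lambda>n. (norm (lin (- b) (- d) u n + lin (cnj l) l v n))\<^sup>2
     + (norm (lin (cnj l) l u n + lin (cnj d) (cnj b) v n))\<^sup>2
     - (norm (lin a c u n))\<^sup>2 - (norm (lin a c v n))\<^sup>2"
  have D: "?D n = K (u n) (v n) - K (delay u n) (delay v n)" for n
    unfolding lin_def K_def by (rule rotation_telescope[OF h1 h2])
  \<comment> \<open>The lower end of the telescope vanishes since \<open>delay\<close> is 0 at index
    0 and \<open>K 0 0 = 0\<close>; the upper end tends to 0 because square-summable sequences
    do.\<close>
  have "(\<Sum>n<Suc N. ?D n) = K (u N) (v N)" for N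
    unfolding D by (induction N) (simp_all add: K_def)
  moreover have "(\<lambda>N. K (u N) (v N)) \<longlonglongrightarrow> K 0 0"
    unfolding K_def by (intro tendsto_intros l2_tendsto_0 u v)
  ultimately have "(\<lambda>N. \<Sum>n<Suc N. ?D n) \<longlonglongrightarrow> 0"
    by (simp add: K_def)
  then have z: "?D sums 0" unfolding sums_def by (rule LIMSEQ_imp_Suc)
  have s: "(\<lambda>n. (norm (x n))\<^sup>2) sums sqnorm x" if "l2 x" for x
    using that unfolding l2_def sqnorm_def by (rule summable_sums)
  have "?D sums (sqnorm (\<lambda>n. lin (- b) (- d) u n + lin (cnj l) l v n)
       + sqnorm (\<lambda>n. lin (cnj l) l u n + lin (cnj d) (cnj b) v n)
       - sqnorm (lin a c u) - sqnorm (lin a c v))"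
    by (intro sums_add sums_diff s l2_add l2_lin u v)
  with z show ?thesis using sums_unique2 by fastforce
qed

section \<open>Coefficients in the Hardy space of the bidisk\<close>

lemma summable_on_geometric_product:
  fixes r s :: real
  assumes "0 \<le> r" "r < 1" "0 \<le> s" "s < 1"
  shows "(\<lambda>(m,n). r ^ m * s ^ n) summable_on (UNIV :: (nat \<times> nat) set)"
proof -
  have geom: "((\<lambda>n. t ^ n) has_sum (1 / (1 - t))) UNIV" if "0 \<le> t" "t < 1" for t :: real
    using that by (intro norm_summable_imp_has_sum geometric_sums) (simp_all add: summable_geometric)
  have "(\<lambda>(m,n). r ^ m * s ^ n) summable_on Sigma UNIV (\<lambda>_. UNIV)"
  proof (rule summable_on_SigmaI[where g = "\<lambda>m. r ^ m * (1 / (1 - s))"])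
    show "((\<lambda>n. case (m, n) of (m, n) \<Rightarrow> r ^ m * s ^ n) has_sum r ^ m * (1 / (1 - s))) UNIV" for m
      using has_sum_cmult_right[OF geom[OF assms(3,4)], of "r ^ m"] by simp
    show "(\<lambda>m. r ^ m * (1 / (1 - s))) summable_on UNIV"
      using geom[OF assms(1,2)] by (intro summable_on_cmult_left) (auto intro: has_sum_imp_summable)
  qed (use assms in auto)
  then show ?thesis by simp
qed

lemma square_summable_abs_summable:
  assumes "(\<lambda>k. (norm (c k))\<^sup>2) summable_on UNIV" "z \<in> bidisk"
  shows "(\<lambda>k. norm (case k of (m,n) \<Rightarrow> c (m,n) * fst z ^ m * snd z ^ n)) summable_on UNIV"
proof (rule Infinite_Sum.abs_summable_on_comparison_test')
  have "0 \<le> norm w \<Longrightarrow> norm w < 1 \<Longrightarrow> (norm w)\<^sup>2 < 1" for w :: complex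
    by (simp add: abs_square_less_1)
  then have "(\<lambda>(m,n). ((norm (fst z))\<^sup>2) ^ m * ((norm (snd z))\<^sup>2) ^ n) summable_on (UNIV :: (nat \<times> nat) set)"
    using assms(2) by (intro summable_on_geometric_product) (auto simp: bidisk_def)
  then show "(\<lambda>k. (norm (c k))\<^sup>2 + (case k of (m,n) \<Rightarrow> ((norm (fst z))\<^sup>2) ^ m * ((norm (snd z))\<^sup>2) ^ n)) summable_on UNIV"
    by (rule summable_on_add[OF assms(1)])
  show "norm (case k of (m, n) \<Rightarrow> c (m, n) * fst z ^ m * snd z ^ n)
      \<le> (norm (c k))\<^sup>2 + (case k of (m,n) \<Rightarrow> ((norm (fst z))\<^sup>2) ^ m * ((norm (snd z))\<^sup>2) ^ n)"
    if "k \<in> UNIV" for k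
  proof (cases k)
    case (Pair m n)
    have sq: "(norm (w ^ n))\<^sup>2 = ((norm w)\<^sup>2) ^ n" for w :: complex and n
      by (metis norm_power power_mult mult.commute)
    have "norm (c k * (fst z ^ m * snd z ^ n)) \<le> (norm (c k))\<^sup>2 + (norm (fst z ^ m * snd z ^ n))\<^sup>2"
      by (rule norm_mult_le_squares)
    also have "(norm (fst z ^ m * snd z ^ n))\<^sup>2 = ((norm (fst z))\<^sup>2) ^ m * ((norm (snd z))\<^sup>2) ^ n"
      by (simp only: norm_mult power_mult_distrib sq)
    finally show ?thesis using Pair by (simp add: mult.assoc)
  qed
qed

lemma has_sum_powser_of_l2:
  assumes "disc_coeffs g u" "norm w < 1"
  shows "((\<lambda>n. u n * w ^ n) has_sum g w) UNIV"
  using assms l2_abs_summable unfolding disc_coeffs_def by (auto intro: norm_summable_imp_has_sum)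

lemma has_sum_sqnorm:
  assumes "l2 u"
  shows "((\<lambda>n. (norm (u n))\<^sup>2) has_sum sqnorm u) UNIV"
  using assms unfolding l2_def sqnorm_def
  by (intro norm_summable_imp_has_sum summable_sums) simp_all

text \<open>Membership criterion for an expansion in powers of \<open>z1\<close> whose coefficients
  are functions of \<open>z2\<close>. Bounded row energies make the double sequence square summable;
  the double series then converges absolutely on the bidisk and may be summed row by row.\<close>

lemma has_H2_coeffs_of_rows:
  assumes rows: "\<And>m. disc_coeffs (Y m) (y m)"
    and bound: "\<And>N. (\<Sum>m<N. sqnorm (y m)) \<le> M"
    and F: "\<And>z. z \<in> bidisk \<Longrightarrow> (\<lambda>m. Y m (snd z) * fst z ^ m) sums F z"
  shows "has_H2_coeffs F (\<lambda>(m,n). y m n)"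
proof -
  have l2: "l2 (y m)" for m using rows by (simp add: disc_coeffs_def)
  have "summable (\<lambda>m. sqnorm (y m))"
    using l2 sqnorm_nonneg bound by (intro summableI_nonneg_bounded[where x = M]) auto
  then have "(\<lambda>m. sqnorm (y m)) summable_on UNIV"
    using l2 sqnorm_nonneg by (subst summable_on_UNIV_nonneg_real_iff) auto
  then have "(\<lambda>(m,n). (norm (y m n))\<^sup>2) summable_on Sigma UNIV (\<lambda>_. UNIV)"
    using has_sum_sqnorm[OF l2] by (intro summable_on_SigmaI[where g = "\<lambda>m. sqnorm (y m)"]) auto
  then have sq: "(\<lambda>k. (norm (case k of (m,n) \<Rightarrow> y m n))\<^sup>2) summable_on UNIV"
    by (simp add: case_prod_unfold)
  have "((\<lambda>(m,n). y m n * fst z ^ m * snd z ^ n) has_sum F z) UNIV" if z: "z \<in> bidisk" for z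
  proof -
    have "(\<lambda>(m,n). y m n * fst z ^ m * snd z ^ n) summable_on UNIV"
      using abs_summable_summable[OF square_summable_abs_summable[OF sq z]] by simp
    then obtain S where S: "((\<lambda>(m,n). y m n * fst z ^ m * snd z ^ n) has_sum S) (Sigma UNIV (\<lambda>_. UNIV))"
      by (auto simp: summable_on_def)
    have "((\<lambda>n. case (m, n) of (m, n) \<Rightarrow> y m n * fst z ^ m * snd z ^ n) has_sum (Y m (snd z) * fst z ^ m)) UNIV" for m
      using has_sum_cmult_left[OF has_sum_powser_of_l2[OF rows[of m], of "snd z"], where c = "fst z ^ m"] z
      by (simp add: bidisk_def mult_ac)
    from has_sum_SigmaD[OF S this] have "(\<lambda>m. Y m (snd z) * fst z ^ m) sums S"
      by (rule has_sum_imp_sums)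
    then have "S = F z" using F[OF z] by (rule sums_unique2)
    then show ?thesis using S by simp
  qed
  with sq show ?thesis by (simp add: has_H2_coeffs_def)
qed

lemma rows_of_square_summable:
  assumes "(\<lambda>k. (norm (c k))\<^sup>2) summable_on (UNIV :: (nat \<times> nat) set)"
  shows "l2 (\<lambda>n. c (m, n))"
    and "(\<Sum>m<N. sqnorm (\<lambda>n. c (m, n))) \<le> (\<Sum>\<^sub>\<infinity>k. (norm (c k))\<^sup>2)"
proof -
  have s: "(\<lambda>(m,n). (norm (c (m,n)))\<^sup>2) summable_on Sigma UNIV (\<lambda>_. UNIV)"
    using assms by (simp add: case_prod_unfold)
  show l2: "l2 (\<lambda>n. c (m, n))" for m
    unfolding l2_def by (rule summable_on_imp_summable, rule summable_on_SigmaD1[OF s]) simp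
  have "((\<lambda>k. (norm (c k))\<^sup>2) has_sum (\<Sum>\<^sub>\<infinity>k. (norm (c k))\<^sup>2)) (Sigma UNIV (\<lambda>_. UNIV))"
    using assms by simp
  from has_sum_SigmaD[OF this has_sum_sqnorm[OF l2]]
  have "((\<lambda>m. sqnorm (\<lambda>n. c (m, n))) has_sum (\<Sum>\<^sub>\<infinity>k. (norm (c k))\<^sup>2)) UNIV" .
  then show "(\<Sum>m<N. sqnorm (\<lambda>n. c (m, n))) \<le> (\<Sum>\<^sub>\<infinity>k. (norm (c k))\<^sup>2)"
    by (rule finite_sum_le_has_sum) (use l2 sqnorm_nonneg in auto)
qed

lemma H2_rows:
  assumes "has_H2_coeffs F c"
  shows "disc_coeffs (\<lambda>w. \<Sum>n. c (m, n) * w ^ n) (\<lambda>n. c (m, n))"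
    and "norm z1 < 1 \<Longrightarrow> norm w < 1 \<Longrightarrow> (\<lambda>m. (\<Sum>n. c (m, n) * w ^ n) * z1 ^ m) sums F (z1, w)"
proof -
  have sq: "(\<lambda>k. (norm (c k))\<^sup>2) summable_on UNIV"
    using assms by (simp add: has_H2_coeffs_def)
  show r: "disc_coeffs (\<lambda>w. \<Sum>n. c (m, n) * w ^ n) (\<lambda>n. c (m, n))" for m
    by (rule disc_coeffs_suminf) (rule rows_of_square_summable[OF sq])
  assume z: "norm z1 < 1" "norm w < 1"
  have S: "((\<lambda>(m,n). c (m,n) * z1 ^ m * w ^ n) has_sum F (z1, w)) (Sigma UNIV (\<lambda>_. UNIV))"
    using assms z unfolding has_H2_coeffs_def by (auto dest!: bspec[of _ _ "(z1, w)"] simp: bidisk_def)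
  have "((\<lambda>n. case (m, n) of (m, n) \<Rightarrow> c (m,n) * z1 ^ m * w ^ n) has_sum ((\<Sum>n. c (m, n) * w ^ n) * z1 ^ m)) UNIV" for m
    using has_sum_cmult_left[OF has_sum_powser_of_l2[OF r[of m] z(2)], where c = "z1 ^ m"]
    by (simp add: mult_ac)
  from has_sum_SigmaD[OF S this] show "(\<lambda>m. (\<Sum>n. c (m, n) * w ^ n) * z1 ^ m) sums F (z1, w)"
    by (rule has_sum_imp_sums)
qed

lemma powser_zero_coeffs:
  fixes u :: "nat \<Rightarrow> complex"
  assumes "\<And>w. norm w < 1 \<Longrightarrow> (\<lambda>n. u n * w ^ n) sums 0"
  shows "u n = 0"
proof (rule ccontr)
  assume n: "u n \<noteq> 0"
  have "u 0 = 0"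
    using sums_unique2[OF assms[of 0] powser_sums_zero] by simp
  then have "n > 0" using n by (cases n) auto
  have "\<And>w. norm (w - 0) < 1 \<Longrightarrow> (\<lambda>n. u n * (w - 0) ^ n) sums 0"
    using assms by simp
  \<comment> \<open>A nonzero coefficient would make 0 an isolated zero of the sum, but the sum is
    the constant 0.\<close>
  from powser_0_nonzero[OF zero_less_one this refl n \<open>n > 0\<close>]
  obtain s where s: "0 < s" "\<And>z. z \<in> cball 0 s - {0::complex} \<Longrightarrow> (0::complex) \<noteq> 0"
    by blast
  have "complex_of_real s \<in> cball 0 s - {0}" using s(1) by simp
  with s(2) show False by blast
qed

lemma has_H2_coeffs_diff:
  assumes "has_H2_coeffs F c" "has_H2_coeffs F c'" "norm z1 < 1" "norm w < 1"
  shows "(\<lambda>m. ((\<Sum>n. c (m, n) * w ^ n) - (\<Sum>n. c' (m, n) * w ^ n)) * z1 ^ m) sums 0"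
  using sums_diff[OF H2_rows(2)[OF assms(1,3,4)] H2_rows(2)[OF assms(2,3,4)]]
  by (simp add: left_diff_distrib)

text \<open>Uniqueness for power series is applied twice: first in \<open>z1\<close> for fixed
  \<open>z2\<close>, then in \<open>z2\<close> for each row. Hence the choice made in
  \<open>h2_coeff\<close> is forced.\<close>

lemma has_H2_coeffs_unique:
  assumes "has_H2_coeffs F c" "has_H2_coeffs F c'"
  shows "c = c'"
proof
  fix k :: "nat \<times> nat"
  obtain m n where k: "k = (m, n)" by (cases k)
  have eq: "(\<Sum>n. c (m, n) * w ^ n) = (\<Sum>n. c' (m, n) * w ^ n)" if "norm w < 1" for w
    using powser_zero_coeffs[OF has_H2_coeffs_diff[OF assms _ that], of m] by simp
  have "(\<lambda>n. (c (m, n) - c' (m, n)) * w ^ n) sums 0" if w: "norm w < 1" for w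
  proof -
    have "(\<lambda>n. c (m, n) * w ^ n) sums (\<Sum>n. c (m, n) * w ^ n)"
      "(\<lambda>n. c' (m, n) * w ^ n) sums (\<Sum>n. c' (m, n) * w ^ n)"
      using H2_rows(1)[OF assms(1), of m] H2_rows(1)[OF assms(2), of m] w
      by (simp_all add: disc_coeffs_def)
    from sums_diff[OF this] show ?thesis by (simp add: eq[OF w] left_diff_distrib)
  qed
  from powser_zero_coeffs[OF this, of n] show "c k = c' k" by (simp add: k)
qed

lemma h2_coeff_eq: "has_H2_coeffs F c \<Longrightarrow> h2_coeff F = c"
  unfolding h2_coeff_def by (blast intro: some_equality has_H2_coeffs_unique)

section \<open>Multiplication by \<open>z1\<close> and its adjoint, the backward shift\<close>

definition shift1 :: "(nat \<times> nat \<Rightarrow> complex) \<Rightarrow> nat \<times> nat \<Rightarrow> complex" where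
  "shift1 c = (\<lambda>(m, n). case m of 0 \<Rightarrow> 0 | Suc k \<Rightarrow> c (k, n))"

lemma has_sum_shift1_iff:
  assumes "\<And>n. h (0, n) = 0"
  shows "((\<lambda>(m,n). h (Suc m, n)) has_sum S) UNIV \<longleftrightarrow> (h has_sum S) (UNIV :: (nat \<times> nat) set)"
proof -
  have "((\<lambda>(m,n). h (Suc m, n)) has_sum S) UNIV \<longleftrightarrow> (h has_sum S) (range (\<lambda>(m,n). (Suc m, n)))"
    by (subst has_sum_reindex) (auto simp: inj_on_def o_def case_prod_unfold)
  also have "\<dots> \<longleftrightarrow> (h has_sum S) UNIV"
  proof (rule has_sum_cong_neutral)
    fix k :: "nat \<times> nat" assume "k \<in> UNIV - range (\<lambda>(m,n). (Suc m, n))"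
    then show "h k = 0" using assms by (cases k, cases "fst k") (force simp: image_iff)+
  qed auto
  finally show ?thesis .
qed

lemma has_H2_coeffs_shift1:
  assumes "has_H2_coeffs f c"
  shows "has_H2_coeffs (\<lambda>z. fst z * f z) (shift1 c)"
  unfolding has_H2_coeffs_def
proof (intro conjI ballI)
  have "(\<lambda>k. (norm (c k))\<^sup>2) summable_on UNIV"
    using assms by (simp add: has_H2_coeffs_def)
  then obtain S where "((\<lambda>(m,n). (norm (shift1 c (Suc m, n)))\<^sup>2) has_sum S) UNIV"
    by (auto simp: summable_on_def shift1_def case_prod_unfold)
  then have "((\<lambda>k. (norm (shift1 c k))\<^sup>2) has_sum S) UNIV"
    by (subst (asm) has_sum_shift1_iff) (simp_all add: shift1_def)
  then show "(\<lambda>k. (norm (shift1 c k))\<^sup>2) summable_on UNIV"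
    by (rule has_sum_imp_summable)
next
  fix z :: "complex \<times> complex" assume "z \<in> bidisk"
  then have "((\<lambda>(m,n). c (m,n) * fst z ^ m * snd z ^ n) has_sum f z) UNIV"
    using assms by (simp add: has_H2_coeffs_def)
  from has_sum_cmult_right[OF this, of "fst z"]
  have "((\<lambda>(m,n). (\<lambda>(m,n). shift1 c (m,n) * fst z ^ m * snd z ^ n) (Suc m, n)) has_sum (fst z * f z)) UNIV"
    by (simp add: shift1_def case_prod_unfold mult_ac)
  then show "((\<lambda>(m,n). shift1 c (m,n) * fst z ^ m * snd z ^ n) has_sum (fst z * f z)) UNIV"
    by (subst (asm) has_sum_shift1_iff) (simp_all add: shift1_def)
qed

lemma h2_inner_shift1:
  assumes "has_H2_coeffs f c" "has_H2_coeffs g e"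
  shows "h2_inner (\<lambda>z. fst z * f z) g = (\<Sum>\<^sub>\<infinity>k. c k * cnj (e (Suc (fst k), snd k)))"
proof -
  have "infsum (\<lambda>(m,n). (\<lambda>k. shift1 c k * cnj (e k)) (Suc m, n)) UNIV = (\<Sum>\<^sub>\<infinity>k. shift1 c k * cnj (e k))"
    by (rule infsum_eqI') (rule has_sum_shift1_iff, simp add: shift1_def)
  then show ?thesis
    unfolding h2_inner_def h2_coeff_eq[OF has_H2_coeffs_shift1[OF assms(1)]] h2_coeff_eq[OF assms(2)]
    by (simp add: shift1_def case_prod_unfold)
qed

text \<open>After reindexing, both inner products are literally the same infinite sum over the
  coefficients.\<close>

lemma Mz1_adjoint_backward_shift:
  assumes "has_H2_coeffs g e" "has_H2_coeffs h (\<lambda>k. e (Suc (fst k), snd k))"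
  shows "Mz1_adjoint_is g h"
  unfolding Mz1_adjoint_is_def
proof (intro conjI ballI)
  show "g \<in> H2" "h \<in> H2" using assms by (auto simp: H2_def)
  fix f assume "f \<in> H2"
  then obtain c where c: "has_H2_coeffs f c" by (auto simp: H2_def)
  show "h2_inner (\<lambda>z. fst z * f z) g = h2_inner f h"
    unfolding h2_inner_shift1[OF c assms(1)] by (simp add: h2_inner_def h2_coeff_eq[OF c] h2_coeff_eq[OF assms(2)])
qed

lemma has_H2_coeffs_monomial:
  "has_H2_coeffs (\<lambda>z. fst z ^ p * snd z ^ q) (\<lambda>k. if k = (p, q) then 1 else 0)"
  unfolding has_H2_coeffs_def
proof (intro conjI ballI)
  show "(\<lambda>k. (norm (if k = (p, q) then 1 else 0 :: complex))\<^sup>2) summable_on UNIV"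
    by (rule has_sum_imp_summable[where S = 1], rule has_sum_finite_neutralI[of "{(p, q)}"]) auto
  show "((\<lambda>(m,n). (if (m, n) = (p, q) then 1 else 0) * fst z ^ m * snd z ^ n) has_sum (fst z ^ p * snd z ^ q)) UNIV"
    for z :: "complex \<times> complex"
    by (rule has_sum_finite_neutralI[of "{(p, q)}"]) (auto split: if_splits)
qed

text \<open>Testing the adjoint relation against the monomial \<open>z1^p z2^q\<close> reads off a
  single coefficient on each side.\<close>

lemma Mz1_adjoint_coeffs:
  assumes "Mz1_adjoint_is g h" "has_H2_coeffs g e" "has_H2_coeffs h k"
  shows "k (p, q) = e (Suc p, q)"
proof -
  let ?f = "\<lambda>z::complex \<times> complex. fst z ^ p * snd z ^ q"
  let ?c = "\<lambda>k. if k = (p, q) then 1 else 0 :: complex"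
  have ev: "(\<Sum>\<^sub>\<infinity>k. ?c k * x k) = x (p, q)" for x
    by (rule infsumI, rule has_sum_finite_neutralI[of "{(p, q)}"]) auto
  have f: "has_H2_coeffs ?f ?c" by (rule has_H2_coeffs_monomial)
  then have "h2_inner (\<lambda>z. fst z * ?f z) g = h2_inner ?f h"
    using assms(1) by (auto simp: Mz1_adjoint_is_def H2_def)
  moreover have "h2_inner ?f h = cnj (k (p, q))"
    unfolding h2_inner_def h2_coeff_eq[OF f] h2_coeff_eq[OF assms(3)] ev ..
  moreover have "h2_inner (\<lambda>z. fst z * ?f z) g = cnj (e (Suc p, q))"
    unfolding h2_inner_shift1[OF f assms(2)] ev by simp
  ultimately show ?thesis by simp
qed

lemma Mz1_adjoint_unique:
  assumes "Mz1_adjoint_is g h" "Mz1_adjoint_is g h'" "z \<in> bidisk"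
  shows "h z = h' z"
proof -
  obtain e k k' where e: "has_H2_coeffs g e" and k: "has_H2_coeffs h k" and k': "has_H2_coeffs h' k'"
    using assms by (auto simp: Mz1_adjoint_is_def H2_def)
  have "k = k'"
    using Mz1_adjoint_coeffs[OF assms(1) e k] Mz1_adjoint_coeffs[OF assms(2) e k'] by auto
  then show ?thesis
    using k k' assms(3) unfolding has_H2_coeffs_def by (blast intro: has_sum_unique)
qed

text \<open>The equation \<open>F x = F 0 + x * h x\<close> determines \<open>h\<close> only for
  \<open>x \<noteq> 0\<close>; continuity at 0 supplies the missing value
  \<open>C (Suc 0)\<close>.\<close>

lemma powser_quotient_tail:
  fixes C :: "nat \<Rightarrow> complex"
  assumes F: "\<And>x. norm x < 1 \<Longrightarrow> (\<lambda>m. C m * x ^ m) sums F x"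
    and h: "\<And>x. norm x < 1 \<Longrightarrow> F x = F 0 + x * h x"
    and cont: "(h \<longlongrightarrow> h 0) (at 0)"
    and x: "norm x < 1"
  shows "(\<lambda>m. C (Suc m) * x ^ m) sums h x"
proof -
  have F0: "F 0 = C 0" using sums_unique2[OF F[of 0] powser_sums_zero] by simp
  have nz: "(\<lambda>m. C (Suc m) * x ^ m) sums h x" if "x \<noteq> 0" "norm x < 1" for x
  proof -
    have "(\<lambda>m. C (Suc m) * x ^ Suc m) sums (x * h x)"
      using F[OF that(2)] h[OF that(2)] F0 by (subst sums_Suc_iff) (simp add: add.commute)
    from sums_divide[OF this, of x] show ?thesis using that(1) by (simp add: field_simps)
  qed
  have "(h \<longlongrightarrow> C (Suc 0)) (at 0)"
    by (rule powser_limit_0_strong[OF zero_less_one, of "\<lambda>m. C (Suc m)"]) (rule nz)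
  then have "h 0 = C (Suc 0)" using cont LIM_unique by blast
  then show ?thesis
    using nz[of x] x powser_sums_zero[of "\<lambda>m. C (Suc m)"] by (cases "x = 0") auto
qed

lemma H2_tendsto_fst_0:
  assumes "F \<in> H2" "norm w < 1"
  shows "((\<lambda>x. F (x, w)) \<longlongrightarrow> F (0, w)) (at 0)"
proof -
  obtain c where c: "has_H2_coeffs F c" using assms(1) by (auto simp: H2_def)
  let ?C = "\<lambda>m. \<Sum>n. c (m, n) * w ^ n"
  have s: "\<And>x. norm x < 1 \<Longrightarrow> (\<lambda>m. ?C m * x ^ m) sums F (x, w)"
    by (rule H2_rows(2)[OF c _ assms(2)])
  have "((\<lambda>x. F (x, w)) \<longlongrightarrow> ?C 0) (at 0)"
    by (rule powser_limit_0[OF zero_less_one]) (rule s)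
  moreover have "F (0, w) = ?C 0"
    using sums_unique2[OF s[of 0] powser_sums_zero] by simp
  ultimately show ?thesis by simp
qed

text \<open>Turns a pointwise identity into an adjoint relation: for fixed \<open>w\<close> it
  identifies the \<open>z1\<close> coefficients of \<open>h\<close> as the shifted ones of
  \<open>F\<close>. Dropping row 0 does not increase the energy, so \<open>h\<close> inherits square
  summability.\<close>

lemma Mz1_adjoint_isI:
  assumes "F \<in> H2"
    and h: "\<And>x w. norm x < 1 \<Longrightarrow> norm w < 1 \<Longrightarrow> F (x, w) = F (0, w) + x * h (x, w)"
    and cont: "\<And>w. norm w < 1 \<Longrightarrow> ((\<lambda>x. h (x, w)) \<longlongrightarrow> h (0, w)) (at 0)"
  shows "Mz1_adjoint_is F h"
proof -
  obtain c where c: "has_H2_coeffs F c" using assms(1) by (auto simp: H2_def)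
  then have sq: "(\<lambda>k. (norm (c k))\<^sup>2) summable_on UNIV" by (simp add: has_H2_coeffs_def)
  have "has_H2_coeffs h (\<lambda>(m, n). (\<lambda>m n. c (Suc m, n)) m n)"
  proof (rule has_H2_coeffs_of_rows)
    show "disc_coeffs (\<lambda>w. \<Sum>n. c (Suc m, n) * w ^ n) (\<lambda>n. c (Suc m, n))" for m
      by (rule H2_rows(1)[OF c])
    show "(\<Sum>m<N. sqnorm (\<lambda>n. c (Suc m, n))) \<le> (\<Sum>\<^sub>\<infinity>k. (norm (c k))\<^sup>2)" for N
    proof -
      have "(\<Sum>m<N. sqnorm (\<lambda>n. c (Suc m, n))) \<le> (\<Sum>m<Suc N. sqnorm (\<lambda>n. c (m, n)))"
        using sqnorm_nonneg[OF rows_of_square_summable(1)[OF sq, of 0]]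
        by (simp add: sum.lessThan_Suc_shift del: sum.lessThan_Suc)
      also have "\<dots> \<le> (\<Sum>\<^sub>\<infinity>k. (norm (c k))\<^sup>2)"
        by (rule rows_of_square_summable(2)[OF sq])
      finally show ?thesis .
    qed
    show "(\<lambda>m. (\<Sum>n. c (Suc m, n) * snd z ^ n) * fst z ^ m) sums h z" if z: "z \<in> bidisk" for z
    proof -
      have w: "norm (snd z) < 1" and x: "norm (fst z) < 1" using z by (auto simp: bidisk_def)
      from powser_quotient_tail[where F = "\<lambda>x. F (x, snd z)" and h = "\<lambda>x. h (x, snd z)", OF H2_rows(2)[OF c _ w] h[OF _ w] cont[OF w] x]
      show ?thesis by simp
    qed
  qed
  then show ?thesis
    by (intro Mz1_adjoint_backward_shift[OF c]) (simp add: case_prod_unfold)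
qed

section \<open>One factor as a conservative system\<close>

text \<open>The conditions on \<open>p = a + b z\<^sub>1 + c z\<^sub>2 + d z\<^sub>1 z\<^sub>2\<close> and \<open>l = \<lambda>\<close> that are used.
  The zero \<open>\<tau>\<close> does not occur since \<open>\<lambda> \<tau>\<^sub>2 = - cnj \<lambda>\<close>, so that
  \<open>\<lambda> (z\<^sub>2 - \<tau>\<^sub>2) = cnj l + l * z\<^sub>2\<close>.\<close>

locale factor11 =
  fixes a b c d l :: complex
  assumes ca: "norm c < norm a"
    and cross: "cnj a * c - d * cnj b = l\<^sup>2"
    and diag: "(norm a)\<^sup>2 + (norm c)\<^sup>2 - (norm b)\<^sup>2 - (norm d)\<^sup>2 = 2 * (norm l)\<^sup>2"
    and dominated: "\<And>w. norm w < 1 \<Longrightarrow> norm (b + d * w) \<le> norm (a + c * w)"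
begin

lemma A_nonzero: "norm w \<le> 1 \<Longrightarrow> a + c * w \<noteq> 0"
  by (rule linear_nonzero_on_disc[OF ca])

lemma p_nonzero:
  assumes "norm z1 < 1" "norm w < 1"
  shows "(a + c * w) + (b + d * w) * z1 \<noteq> 0"
proof
  assume "(a + c * w) + (b + d * w) * z1 = 0"
  then have "norm (a + c * w) = norm (b + d * w) * norm z1"
    by (metis add_eq_0_iff2 norm_minus_cancel norm_mult)
  also have "\<dots> \<le> norm (a + c * w) * norm z1"
    using dominated[OF assms(2)] by (simp add: mult_right_mono)
  also have "\<dots> < norm (a + c * w)"
    using A_nonzero[of w] assms by simp
  finally show False by simp
qed

text \<open>By \<open>cross\<close>, \<open>diag\<close> and the conjugate of \<open>cross\<close>
  the coefficients of \<open>w^2\<close>, \<open>w\<close> and \<open>1\<close> are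
  \<open>l^2\<close>, \<open>2 l cnj l\<close> and \<open>(cnj l)^2\<close>, a perfect square. As a
  polynomial identity it holds for all \<open>w\<close>, not only on the circle.\<close>

lemma determinant:
  "(cnj a * w + cnj c) * (a + c * w) - (b + d * w) * (cnj b * w + cnj d) = (cnj l + l * w)\<^sup>2"
proof -
  have cross': "a * cnj c - cnj d * b = (cnj l)\<^sup>2"
    using arg_cong[OF cross, of cnj] by simp
  have diag': "a * cnj a + c * cnj c - b * cnj b - d * cnj d = 2 * (l * cnj l)"
    using arg_cong[OF diag, of complex_of_real]
    by (simp only: of_real_diff of_real_add of_real_mult complex_norm_square of_real_numeral)
  have "(cnj a * w + cnj c) * (a + c * w) - (b + d * w) * (cnj b * w + cnj d)
     = (cnj a * c - d * cnj b) * w\<^sup>2 + (a * cnj a + c * cnj c - b * cnj b - d * cnj d) * w + (a * cnj c - cnj d * b)"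
    by algebra
  also have "\<dots> = (cnj l + l * w)\<^sup>2"
    unfolding cross cross' diag' by algebra
  finally show ?thesis .
qed

text \<open>For fixed \<open>w = z\<^sub>2\<close> the function \<open>\<theta>\<close> is the transfer function in \<open>z\<^sub>1\<close> of a
  one-dimensional system with state \<open>x\<close>, input \<open>g\<close> and output \<open>y\<close>, whose system matrix is
  unitary for \<open>\<bar>w\<bar> = 1\<close>. Running the system on \<open>\<ell>\<^sup>2\<close>-valued signals conserves energy, which
  bounds the output although the denominator vanishes on the torus.\<close>

lemma state_space_H2:
  assumes G: "G \<in> H2" and X0: "disc_coeffs X0 x0"
  shows "(\<lambda>z. (cnj a * fst z * snd z + cnj b * snd z + cnj c * fst z + cnj d)
              / (a + b * fst z + c * snd z + d * fst z * snd z) * G z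
            + (cnj l + l * snd z) / (a + b * fst z + c * snd z + d * fst z * snd z) * X0 (snd z)) \<in> H2"
    (is "?F \<in> H2")
proof -
  obtain g where g: "has_H2_coeffs G g" using G by (auto simp: H2_def)
  have sq: "(\<lambda>k. (norm (g k))\<^sup>2) summable_on UNIV" using g by (simp add: has_H2_coeffs_def)
  define M where "M = (\<Sum>\<^sub>\<infinity>k. (norm (g k))\<^sup>2)"
  define gr where "gr = (\<lambda>m n. g (m, n))"
  define Gf where "Gf = (\<lambda>m w. \<Sum>n. gr m n * w ^ n)"
  have Gf: "disc_coeffs (Gf m) (gr m)" for m
    unfolding Gf_def gr_def by (rule H2_rows(1)[OF g])
  \<comment> \<open>The system is run twice in parallel: \<open>x\<close>, \<open>y\<close> are
    coefficient sequences in \<open>w\<close>, for the energy estimate, and \<open>Xf\<close>,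
    \<open>Yf\<close> below are the functions they represent, for the evaluation.\<close>
  define nextx where "nextx = (\<lambda>m x n. lin (- b) (- d) (divlin a c x) n + lin (cnj l) l (divlin a c (gr m)) n)"
  define x where "x = rec_nat x0 nextx"
  define y where "y = (\<lambda>m n. lin (cnj l) l (divlin a c (x m)) n + lin (cnj d) (cnj b) (divlin a c (gr m)) n)"
  have x_0: "x 0 = x0" and x_Suc: "x (Suc m) = nextx m (x m)" for m
    by (simp_all add: x_def)
  define A B s t where "A = (\<lambda>w. a + c * w)" and "B = (\<lambda>w. - b + - d * w)"
    and "s = (\<lambda>w. cnj l + l * w)" and "t = (\<lambda>w. cnj d + cnj b * w)"
  define Xf where "Xf = rec_nat X0 (\<lambda>m X w. B w * (X w / A w) + s w * (Gf m w / A w))"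
  define Yf where "Yf = (\<lambda>m w. s w * (Xf m w / A w) + t w * (Gf m w / A w))"
  have X_0: "Xf 0 = X0" and X_Suc: "Xf (Suc m) = (\<lambda>w. B w * (Xf m w / A w) + s w * (Gf m w / A w))" for m
    by (simp_all add: Xf_def)
  have X: "disc_coeffs (Xf m) (x m)" for m
  proof (induction m)
    case (Suc m)
    show ?case
      unfolding X_Suc x_Suc nextx_def A_def B_def s_def
      by (intro disc_coeffs_add disc_coeffs_lin disc_coeffs_divlin ca Suc Gf)
  qed (simp add: X_0 x_0 X0)
  have Y: "disc_coeffs (Yf m) (y m)" for m
    unfolding Yf_def y_def A_def s_def t_def
    by (intro disc_coeffs_add disc_coeffs_lin disc_coeffs_divlin ca X Gf)
  have l2x: "l2 (x m)" and l2g: "l2 (gr m)" and l2y: "l2 (y m)" for m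
    using X Y Gf by (auto simp: disc_coeffs_def)
  have a0: "a \<noteq> 0" using ca by auto
  \<comment> \<open>The isometry is applied to the sequences already divided by
    \<open>a + c w\<close>; on its right hand side \<open>lin_divlin\<close> undoes the
    division.\<close>
  have step: "sqnorm (x (Suc m)) + sqnorm (y m) = sqnorm (x m) + sqnorm (gr m)" for m
    using rotation_isometric[OF cross diag l2_divlin[OF ca l2x[of m]] l2_divlin[OF ca l2g[of m]]]
    unfolding lin_divlin[OF a0] x_Suc nextx_def y_def .
  have energy: "sqnorm (x N) + (\<Sum>m<N. sqnorm (y m)) = sqnorm x0 + (\<Sum>m<N. sqnorm (gr m))" for N
  proof (induction N)
    case (Suc N)
    then show ?case using step[of N] by simp
  qed (simp add: x_0)
  have gM: "(\<Sum>m<N. sqnorm (gr m)) \<le> M" for N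
    unfolding M_def gr_def by (rule rows_of_square_summable(2)[OF sq])
  have yM: "(\<Sum>m<N. sqnorm (y m)) \<le> sqnorm x0 + M" for N
    using energy[of N] gM[of N] sqnorm_nonneg[OF l2x[of N]] by linarith
  have xM: "sqnorm (x N) \<le> sqnorm x0 + M" for N
    using energy[of N] gM[of N] sum_nonneg[of "{..<N}" "\<lambda>m. sqnorm (y m)"] sqnorm_nonneg[OF l2y]
    by fastforce
  have "has_H2_coeffs ?F (\<lambda>(m, n). y m n)"
  proof (rule has_H2_coeffs_of_rows[OF Y yM])
    fix z :: "complex \<times> complex" assume z: "z \<in> bidisk"
    define z1 w where "z1 = fst z" and "w = snd z"
    have z1: "norm z1 < 1" and w: "norm w < 1" using z by (auto simp: z1_def w_def bidisk_def)
    have w2: "(norm w)\<^sup>2 < 1" using w by (simp add: abs_square_less_1)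
    \<comment> \<open>A bound on the states that does not depend on \<open>m\<close>:
      \<open>\<bar>x m n * w^n\<bar>\<close> is at most
      \<open>\<bar>x m n\<bar>^2 + \<bar>w\<bar>^(2n)\<close>, where the first part sums to at most
      \<open>sqnorm x0 + M\<close> and the second is geometric.\<close>
    define C where "C = sqnorm x0 + M + 1 / (1 - (norm w)\<^sup>2)"
    have XC: "norm (Xf m w) \<le> C" for m
    proof -
      have s1: "summable (\<lambda>n. norm (x m n * w ^ n))"
        by (rule l2_abs_summable[OF l2x w])
      have s2: "(\<lambda>n. (norm (x m n))\<^sup>2 + ((norm w)\<^sup>2) ^ n) sums (sqnorm (x m) + 1 / (1 - (norm w)\<^sup>2))"
        using l2x[of m] w2 unfolding l2_def sqnorm_def
        by (intro sums_add summable_sums geometric_sums) simp_all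
      have "Xf m w = (\<Sum>n. x m n * w ^ n)"
        using X[of m] w by (simp add: disc_coeffs_def sums_unique)
      then have "norm (Xf m w) \<le> (\<Sum>n. norm (x m n * w ^ n))"
        using summable_norm[OF s1] by simp
      also have "\<dots> \<le> (\<Sum>n. (norm (x m n))\<^sup>2 + ((norm w)\<^sup>2) ^ n)"
      proof (rule suminf_le[OF _ s1 sums_summable[OF s2]])
        show "norm (x m n * w ^ n) \<le> (norm (x m n))\<^sup>2 + ((norm w)\<^sup>2) ^ n" for n
          using norm_mult_le_squares[of "x m n" "w ^ n"] by (metis norm_power power_mult mult.commute)
      qed
      also have "\<dots> \<le> C" using sums_unique[OF s2] xM[of m] by (simp add: C_def)
      finally show ?thesis .
    qed
    have "summable (\<lambda>m. Xf m w * z1 ^ m)"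
    proof (rule summable_comparison_test')
      show "summable (\<lambda>m. C * norm z1 ^ m)"
        using z1 by (intro summable_mult summable_geometric) simp
      show "norm (Xf m w * z1 ^ m) \<le> C * norm z1 ^ m" if "m \<ge> 0" for m
        unfolding norm_mult norm_power by (rule mult_right_mono[OF XC]) simp
    qed
    then obtain SX where SX: "(\<lambda>m. Xf m w * z1 ^ m) sums SX" by (auto simp: summable_def)
    have SG: "(\<lambda>m. Gf m w * z1 ^ m) sums G (z1, w)"
      unfolding Gf_def gr_def by (rule H2_rows(2)[OF g z1 w])
    have aw: "A w \<noteq> 0" unfolding A_def using w by (intro A_nonzero) simp
    have SY: "(\<lambda>m. Yf m w * z1 ^ m) sums (s w / A w * SX + t w / A w * G (z1, w))"
      using sums_add[OF sums_mult[OF SX, of "s w / A w"] sums_mult[OF SG, of "t w / A w"]]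
      by (simp add: Yf_def algebra_simps)
    have "(\<lambda>m. Xf (Suc m) w * z1 ^ m) sums (B w / A w * SX + s w / A w * G (z1, w))"
      using sums_add[OF sums_mult[OF SX, of "B w / A w"] sums_mult[OF SG, of "s w / A w"]]
      by (simp add: X_Suc algebra_simps)
    from sums_mult[OF this, of z1]
    have "(\<lambda>m. Xf (Suc m) w * z1 ^ Suc m) sums (z1 * (B w / A w * SX + s w / A w * G (z1, w)))"
      by (simp add: mult_ac)
    then have "(\<lambda>m. Xf m w * z1 ^ m) sums (z1 * (B w / A w * SX + s w / A w * G (z1, w)) + X0 w)"
      by (subst (asm) sums_Suc_iff) (simp add: X_0)
    \<comment> \<open>The index shift in the state recursion yields a linear equation for the
      generating function \<open>SX\<close> of the states; solving it produces the denominator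
      \<open>A w - B w * z1\<close>, which is \<open>p\<close>.\<close>
    with SX have "SX = z1 * (B w / A w * SX + s w / A w * G (z1, w)) + X0 w"
      by (rule sums_unique2)
    then have "SX * A w = z1 * (B w * SX + s w * G (z1, w)) + X0 w * A w"
      using aw by (simp add: field_simps)
    then have SX_eq: "SX * (A w - B w * z1) = z1 * s w * G (z1, w) + X0 w * A w"
      by (simp add: algebra_simps)
    have p: "A w - B w * z1 \<noteq> 0"
      using p_nonzero[OF z1 w] by (simp add: A_def B_def algebra_simps)
    have p_eq: "a + b * z1 + c * w + d * z1 * w = A w - B w * z1"
      by (simp add: A_def B_def algebra_simps)
    \<comment> \<open>This replaces \<open>(s w)^2\<close> so that a factor \<open>A w\<close>
      splits off the numerator and cancels, leaving only \<open>p\<close> in the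
      denominator.\<close>
    have det: "(cnj a * w + cnj c) * A w + B w * t w = (s w)\<^sup>2"
      using determinant[of w] by (simp add: A_def B_def s_def t_def algebra_simps)
    have "(s w / A w * SX + t w / A w * G (z1, w)) * (A w * (A w - B w * z1))
        = s w * (SX * (A w - B w * z1)) + t w * G (z1, w) * (A w - B w * z1)"
      using aw by (simp add: field_simps)
    also have "\<dots> = A w * (((cnj a * w + cnj c) * z1 + t w) * G (z1, w) + s w * X0 w)"
      unfolding SX_eq using det by algebra
    finally have "s w / A w * SX + t w / A w * G (z1, w)
        = (A w * (((cnj a * w + cnj c) * z1 + t w) * G (z1, w) + s w * X0 w)) / (A w * (A w - B w * z1))"
      using aw p by (metis nonzero_eq_divide_eq mult_eq_0_iff)
    also have "\<dots> = (((cnj a * w + cnj c) * z1 + t w) * G (z1, w) + s w * X0 w) / (A w - B w * z1)"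
      using aw by simp
    also have "\<dots> = ?F (z1, w)"
      unfolding fst_conv snd_conv p_eq
      by (simp add: t_def s_def add_divide_distrib algebra_simps)
    finally show "(\<lambda>m. Yf m (snd z) * fst z ^ m) sums ?F z"
      using SY by (simp add: z1_def w_def)
  qed
  then show ?thesis by (auto simp: H2_def)
qed

end

section \<open>Consequences of a zero on the torus\<close>

lemma norm_linear_on_circle:
  assumes "norm w = 1"
  shows "(norm (a + c * w))\<^sup>2 = (norm a)\<^sup>2 + (norm c)\<^sup>2 + 2 * Re (cnj a * c * w)"
proof -
  have "complex_of_real ((norm (a + c * w))\<^sup>2)
      = a * cnj a + c * cnj c * (w * cnj w) + (cnj a * c * w + cnj (cnj a * c * w))"
    unfolding complex_norm_square by (simp add: algebra_simps)
  also have "w * cnj w = 1"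
    using assms complex_norm_square[of w] by simp
  also have "a * cnj a + c * cnj c * 1 + (cnj a * c * w + cnj (cnj a * c * w))
      = complex_of_real ((norm a)\<^sup>2 + (norm c)\<^sup>2 + 2 * Re (cnj a * c * w))"
    unfolding complex_add_cnj by (simp add: complex_norm_square[symmetric] flip: of_real_power)
  finally show ?thesis unfolding of_real_eq_iff .
qed

text \<open>If the inequality failed inside the disc, solving \<open>p = 0\<close> for
  \<open>z1\<close> would give a zero in the bidisk. Boundary points follow by the radial limit
  along \<open>n / (n + 1) * w\<close>.\<close>

lemma poly11_dominated:
  assumes nz: "\<forall>z\<in>bidisk. poly11 a b c d z \<noteq> 0" and w: "norm w \<le> 1"
  shows "norm (b + d * w) \<le> norm (a + c * w)"
proof -
  have op: "norm (b + d * v) \<le> norm (a + c * v)" if v: "norm v < 1" for v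
  proof (rule ccontr)
    assume *: "\<not> ?thesis"
    then have B: "b + d * v \<noteq> 0" by auto
    define z1 where "z1 = - ((a + c * v) / (b + d * v))"
    have "norm z1 < 1" unfolding z1_def norm_minus_cancel norm_divide using * B by simp
    then have "(z1, v) \<in> bidisk" using v by (simp add: bidisk_def)
    moreover have "poly11 a b c d (z1, v) = (a + c * v) + (b + d * v) * z1"
      by (simp add: poly11_def algebra_simps)
    moreover have "\<dots> = 0" using B by (simp add: z1_def)
    ultimately show False using nz by metis
  qed
  let ?r = "\<lambda>n. of_real (real n / real (Suc n)) :: complex"
  have r: "?r \<longlonglongrightarrow> of_real 1" by (intro tendsto_of_real LIMSEQ_n_over_Suc_n)
  have "(\<lambda>n. norm (b + d * (?r n * w))) \<longlonglongrightarrow> norm (b + d * (of_real 1 * w))"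
    by (intro tendsto_intros r)
  moreover have "(\<lambda>n. norm (a + c * (?r n * w))) \<longlonglongrightarrow> norm (a + c * (of_real 1 * w))"
    by (intro tendsto_intros r)
  moreover have "norm (b + d * (?r n * w)) \<le> norm (a + c * (?r n * w))" for n
  proof (rule op)
    have "norm (?r n * w) \<le> real n / real (Suc n)"
      unfolding norm_mult norm_of_real abs_of_nonneg[OF divide_nonneg_nonneg[OF of_nat_0_le_iff of_nat_0_le_iff]]
      using w by (intro mult_left_le) auto
    also have "\<dots> < 1" by simp
    finally show "norm (?r n * w) < 1" .
  qed
  ultimately show ?thesis using LIMSEQ_le[of _ _ _ "norm (a + c * (of_real 1 * w))"] by fastforce
qed

lemma bipoly_eval_0_1:
  "bipoly_eval 0 1 P z = P 0 0 + P 0 1 * snd z" "bipoly_eval 1 0 P z = P 0 0 + P 1 0 * fst z"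
  by (simp_all add: bipoly_eval_def)

text \<open>On the circle \<open>\<bar>a + c w\<bar>^2 - \<bar>b + d w\<bar>^2\<close> equals
  \<open>\<beta> + 2 Re (l^2 w)\<close>. It is nonnegative and vanishes at \<open>t2\<close>, so
  \<open>t2\<close> minimises \<open>Re (l^2 w)\<close>, which forces
  \<open>l^2 t2 = - \<bar>l\<bar>^2\<close> and \<open>\<beta> = 2 \<bar>l\<bar>^2\<close>. The
  degree condition excludes the degenerate cases.\<close>

lemma factor11_of_torus_zero:
  assumes nz: "\<forall>z\<in>bidisk. poly11 a b c d z \<noteq> 0"
    and deg: "rat_deg_11 (\<lambda>z. poly11_refl a b c d z / poly11 a b c d z)"
    and tau: "norm t1 = 1" "norm t2 = 1" "poly11 a b c d (t1, t2) = 0"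
    and l: "l\<^sup>2 = cnj a * c - d * cnj b"
  shows "factor11 a b c d l" "l \<noteq> 0" "l * t2 = - cnj l"
proof -
  note dom = poly11_dominated[OF nz]
  define \<beta> where "\<beta> = (norm a)\<^sup>2 + (norm c)\<^sup>2 - (norm b)\<^sup>2 - (norm d)\<^sup>2"
  have q: "(norm (a + c * w))\<^sup>2 - (norm (b + d * w))\<^sup>2 = \<beta> + 2 * Re (l\<^sup>2 * w)" if "norm w = 1" for w
    unfolding norm_linear_on_circle[OF that] l \<beta>_def by (simp add: algebra_simps)
  have q_ge: "\<beta> + 2 * Re (l\<^sup>2 * w) \<ge> 0" if "norm w = 1" for w
    using dom[of w] that power_mono[of "norm (b + d * w)" "norm (a + c * w)" 2]
    unfolding q[OF that, symmetric] by simp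
  have "(a + c * t2) + (b + d * t2) * t1 = 0"
    using tau(3) by (simp add: poly11_def algebra_simps)
  then have "norm (a + c * t2) = norm (b + d * t2)"
    by (metis add_eq_0_iff2 mult.right_neutral norm_minus_cancel norm_mult tau(1))
  then have q0: "\<beta> + 2 * Re (l\<^sup>2 * t2) = 0" using q[OF tau(2)] by simp
  \<comment> \<open>For \<open>l = 0\<close> also \<open>\<beta> = 0\<close>, and then the quotient
    equals its value at \<open>z1 = 0\<close>; it would not depend on \<open>z1\<close>.\<close>
  show l0: "l \<noteq> 0"
  proof
    assume "l = 0"
    then have \<alpha>: "cnj a * c - d * cnj b = 0" and \<beta>: "\<beta> = 0" using l q0 by auto
    have \<alpha>': "a * cnj c - cnj d * b = 0" using arg_cong[OF \<alpha>, of cnj] by simp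
    have \<beta>': "a * cnj a + c * cnj c - b * cnj b - d * cnj d = 0"
      using arg_cong[OF \<beta>, of complex_of_real] unfolding \<beta>_def of_real_diff of_real_add complex_norm_square
      by simp
    have "rat_bideg_le 0 1 (\<lambda>z. poly11_refl a b c d z / poly11 a b c d z)"
      unfolding rat_bideg_le_def
    proof (intro exI ballI)
      fix z assume z: "z \<in> bidisk"
      let ?Q = "\<lambda>i j. if j = 0 then a else c" and ?P = "\<lambda>i j. if j = 0 then cnj d else cnj b"
      have "(0, snd z) \<in> bidisk" using z by (simp add: bidisk_def)
      then have A: "a + c * snd z \<noteq> 0" using nz by (force simp: poly11_def)
      have "poly11_refl a b c d z * (a + c * snd z) = poly11 a b c d z * (cnj d + cnj b * snd z)"
        unfolding poly11_refl_def poly11_def using \<alpha> \<alpha>' \<beta>' by algebra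
      then have "poly11_refl a b c d z / poly11 a b c d z = (cnj d + cnj b * snd z) / (a + c * snd z)"
        using A nz z by (simp add: field_simps)
      with A show "bipoly_eval 0 1 ?Q z \<noteq> 0 \<and>
          poly11_refl a b c d z / poly11 a b c d z = bipoly_eval 0 1 ?P z / bipoly_eval 0 1 ?Q z"
        unfolding bipoly_eval_0_1 by simp
    qed
    then show False using deg by (simp add: rat_deg_11_def)
  qed
  \<comment> \<open>The point of the circle with \<open>l^2 w0 = - \<bar>l\<bar>^2\<close>, where
    \<open>Re (l^2 w)\<close> is smallest.\<close>
  define w0 where "w0 = - (cnj l)\<^sup>2 / of_real ((norm l)\<^sup>2)"
  have w0: "norm w0 = 1" using l0 by (simp add: w0_def norm_divide norm_power)
  have "l\<^sup>2 * w0 = - (l * cnj l)\<^sup>2 / of_real ((norm l)\<^sup>2)"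
    by (simp add: w0_def power_mult_distrib)
  also have "\<dots> = - of_real ((norm l)\<^sup>2)"
    using l0 unfolding complex_norm_square[symmetric] by (simp add: power2_eq_square)
  finally have "Re (l\<^sup>2 * w0) = - (norm l)\<^sup>2" by simp
  then have le: "Re (l\<^sup>2 * t2) \<le> - (norm l)\<^sup>2" using q_ge[OF w0] q0 by simp
  have nlt: "norm (l\<^sup>2 * t2) = (norm l)\<^sup>2" by (simp add: norm_mult norm_power tau)
  \<comment> \<open>The real part is minus the modulus, so the imaginary part vanishes.\<close>
  have Re: "Re (l\<^sup>2 * t2) = - (norm l)\<^sup>2"
    using le abs_Re_le_cmod[of "l\<^sup>2 * t2"] nlt by simp
  have "(Im (l\<^sup>2 * t2))\<^sup>2 = 0"
    using cmod_power2[of "l\<^sup>2 * t2"] unfolding nlt Re by simp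
  then have "l\<^sup>2 * t2 = - of_real ((norm l)\<^sup>2)"
    using Re by (simp add: complex_eq_iff)
  then have "l * (l * t2) = l * (- cnj l)"
    unfolding complex_norm_square by (simp add: power2_eq_square mult_ac)
  then show "l * t2 = - cnj l" using l0 by (metis mult_left_cancel)
  \<comment> \<open>Otherwise \<open>a + c w\<close> has a root \<open>\<zeta>\<close> on the
    circle, where domination makes \<open>b + d w\<close> vanish too. Then
    \<open>z2 - \<zeta>\<close> divides both \<open>p\<close> and its reflection, and the quotient
    would not depend on \<open>z2\<close>.\<close>
  have "norm c < norm a"
  proof (rule ccontr)
    assume ac: "\<not> norm c < norm a"
    have "a \<noteq> 0" using bspec[OF nz, of "(0, 0)"] by (simp add: poly11_def bidisk_def)
    then have c0: "c \<noteq> 0" using ac by auto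
    define \<zeta> where "\<zeta> = - a / c"
    have a: "a = - c * \<zeta>" using c0 by (simp add: \<zeta>_def)
    have "norm \<zeta> \<ge> 1"
    proof (rule ccontr)
      assume "\<not> norm \<zeta> \<ge> 1"
      then have "(0, \<zeta>) \<in> bidisk" by (simp add: bidisk_def)
      then show False using nz a by (force simp: poly11_def)
    qed
    moreover have "norm \<zeta> \<le> 1" using ac c0 by (simp add: \<zeta>_def norm_divide field_simps)
    ultimately have \<zeta>: "norm \<zeta> = 1" by simp
    then have \<zeta>c: "\<zeta> * cnj \<zeta> = 1" using complex_norm_square[of \<zeta>] by simp
    have "norm (b + d * \<zeta>) \<le> 0" using dom[of \<zeta>] \<zeta> a by simp
    then have b: "b = - d * \<zeta>" by (simp add: add_eq_0_iff2)
    have "rat_bideg_le 1 0 (\<lambda>z. poly11_refl a b c d z / poly11 a b c d z)"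
      unfolding rat_bideg_le_def
    proof (intro exI ballI)
      fix z assume z: "z \<in> bidisk"
      let ?Q = "\<lambda>i j. if i = 0 then c else d"
      let ?P = "\<lambda>i j. if i = 0 then - cnj \<zeta> * cnj d else - cnj \<zeta> * cnj c"
      have p: "poly11 a b c d z = (snd z - \<zeta>) * (c + d * fst z)"
        by (simp add: poly11_def a b algebra_simps)
      then have nz': "c + d * fst z \<noteq> 0" "snd z - \<zeta> \<noteq> 0" using nz z by auto
      have "poly11_refl a b c d z = (snd z - \<zeta>) * (- cnj \<zeta> * cnj d + - cnj \<zeta> * cnj c * fst z)"
        unfolding poly11_refl_def a b complex_cnj_mult complex_cnj_minus using \<zeta>c by algebra
      then have "poly11_refl a b c d z / poly11 a b c d z
          = (- cnj \<zeta> * cnj d + - cnj \<zeta> * cnj c * fst z) / (c + d * fst z)"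
        unfolding p using nz'(2) by simp
      with nz' show "bipoly_eval 1 0 ?Q z \<noteq> 0 \<and>
          poly11_refl a b c d z / poly11 a b c d z = bipoly_eval 1 0 ?P z / bipoly_eval 1 0 ?Q z"
        unfolding bipoly_eval_0_1 by simp
    qed
    then show False using deg by (simp add: rat_deg_11_def)
  qed
  moreover have "\<beta> = 2 * (norm l)\<^sup>2" using q0 Re by simp
  ultimately show "factor11 a b c d l"
    unfolding \<beta>_def using l dom by unfold_locales auto
qed

context factor11 begin

text \<open>The strict inequality puts the root in \<open>z1\<close> of the numerator of
  \<open>\<theta>\<close> inside the disc. On the circle, reflection preserves moduli, and the
  squared moduli differ by \<open>\<bar>cnj l + l w\<bar>^2\<close>.\<close>

lemma zero_in_disc_on_circle:
  assumes "norm w = 1" "cnj l + l * w \<noteq> 0"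
  shows "norm (cnj b * w + cnj d) < norm (cnj a * w + cnj c)"
proof -
  have ww: "w * cnj w = 1" using assms complex_norm_square[of w] by simp
  have refl: "norm (cnj x * w + cnj y) = norm (x + y * w)" for x y
  proof -
    have "cnj x * w + cnj y = w * cnj (x + y * w)"
      using ww by (simp add: algebra_simps)
    then show ?thesis using assms(1) by (simp only: norm_mult complex_mod_cnj)
  qed
  have "(norm (a + c * w))\<^sup>2 - (norm (b + d * w))\<^sup>2 = (norm (cnj l + l * w))\<^sup>2"
    unfolding norm_linear_on_circle[OF assms(1)] using diag cross
    by (simp add: power2_eq_square algebra_simps)
  moreover have "(norm (cnj l + l * w))\<^sup>2 > 0" using assms(2) by simp
  ultimately have "(norm (b + d * w))\<^sup>2 < (norm (a + c * w))\<^sup>2" by linarith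
  then show ?thesis unfolding refl by (rule power_less_imp_less_base) simp
qed

end

section \<open>Independence of cascade products and a telescoping identity\<close>

text \<open>At the zero of \<open>T 0\<close> only the term of \<open>g 0\<close> survives, so
  \<open>g 0 = 0\<close>. Elsewhere \<open>T 0\<close> can be divided out, and continuity carries
  the shorter relation across that zero; induction then treats the remaining factors.\<close>

lemma cascade_independent:
  fixes T F :: "nat \<Rightarrow> complex \<Rightarrow> complex" and g :: "nat \<Rightarrow> complex"
  assumes "\<And>k. k < n \<Longrightarrow> continuous_on (ball 0 1) (T k)"
    and "\<And>k. k < n \<Longrightarrow> continuous_on (ball 0 1) (F k)"
    and "\<And>k. k < n \<Longrightarrow> \<exists>\<zeta>\<in>ball 0 1. T k \<zeta> = 0 \<and> (\<forall>z\<in>ball 0 1. z \<noteq> \<zeta> \<longrightarrow> T k z \<noteq> 0)"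
    and "\<And>k z. k < n \<Longrightarrow> z \<in> ball 0 1 \<Longrightarrow> F k z \<noteq> 0"
    and "\<And>z. z \<in> ball 0 1 \<Longrightarrow> (\<Sum>j<n. (\<Prod>k<j. T k z) * F j z * g j) = 0"
    and "j < n"
  shows "g j = 0"
  using assms
proof (induction n arbitrary: T F g j)
  case (Suc n)
  define R where "R = (\<lambda>z. \<Sum>j<n. (\<Prod>k<j. T (Suc k) z) * F (Suc j) z * g (Suc j))"
  have split: "F 0 z * g 0 + T 0 z * R z = 0" if "z \<in> ball 0 1" for z
    using Suc.prems(5)[OF that] unfolding R_def
    by (simp add: sum.lessThan_Suc_shift prod.lessThan_Suc_shift sum_distrib_left mult_ac
        del: sum.lessThan_Suc prod.lessThan_Suc)
  obtain \<zeta> where \<zeta>: "\<zeta> \<in> ball 0 1" "T 0 \<zeta> = 0" "\<And>z. z \<in> ball 0 1 \<Longrightarrow> z \<noteq> \<zeta> \<Longrightarrow> T 0 z \<noteq> 0"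
    using Suc.prems(3)[of 0] by auto
  have g0: "g 0 = 0" using split[OF \<zeta>(1)] \<zeta>(2) Suc.prems(4)[OF _ \<zeta>(1), of 0] by simp
  have R_off: "R z = 0" if "z \<in> ball 0 1" "z \<noteq> \<zeta>" for z
    using split[OF that(1)] \<zeta>(3)[OF that] g0 by simp
  have "continuous_on (ball 0 1) R"
    unfolding R_def using Suc.prems(1,2) by (intro continuous_intros) auto
  then have "(R \<longlongrightarrow> R \<zeta>) (at \<zeta>)"
    using \<zeta>(1) by (metis at_within_open continuous_on_def open_ball)
  moreover have "(R \<longlongrightarrow> 0) (at \<zeta>)"
  proof (rule tendsto_eventually)
    have "eventually (\<lambda>z. z \<in> ball 0 1) (at \<zeta>)"
      using \<zeta>(1) by (metis eventually_at_in_open' open_ball)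
    then show "eventually (\<lambda>z. R z = 0) (at \<zeta>)"
      using eventually_neq_at_within[of \<zeta> \<zeta> UNIV] by eventually_elim (use R_off in auto)
  qed
  ultimately have "R \<zeta> = 0" using LIM_unique by blast
  then have R0: "R z = 0" if "z \<in> ball 0 1" for z using R_off[OF that] by (cases "z = \<zeta>") auto
  show ?case
  proof (cases j)
    case (Suc i)
    have "g (Suc i) = 0"
    proof (rule Suc.IH[where T = "\<lambda>k. T (Suc k)" and F = "\<lambda>k. F (Suc k)" and g = "\<lambda>k. g (Suc k)"])
      show "(\<Sum>j<n. (\<Prod>k<j. T (Suc k) z) * F (Suc j) z * g (Suc j)) = 0" if "z \<in> ball 0 1" for z
        using R0[OF that] by (simp add: R_def)
    qed (use Suc.prems(1-4,6) Suc in auto)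
    then show ?thesis by (simp add: Suc)
  qed (simp add: g0)
qed simp

text \<open>The factors \<open>t\<close> are exchanged for \<open>t0\<close> one at a time, starting
  from the last.\<close>

lemma prod_diff_telescope:
  fixes t t0 :: "nat \<Rightarrow> complex"
  shows "(\<Prod>k=1..<j. t k) - (\<Prod>k=1..<j. t0 k)
    = (\<Sum>i=1..<j. (\<Prod>k=1..<i. t k) * (t i - t0 i) * (\<Prod>k=i+1..<j. t0 k))"
proof (induction j)
  case (Suc j)
  show ?case
  proof (cases "j = 0")
    case False
    have "(\<Sum>i=1..<Suc j. (\<Prod>k=1..<i. t k) * (t i - t0 i) * (\<Prod>k=i+1..<Suc j. t0 k))
      = (\<Sum>i=1..<j. (\<Prod>k=1..<i. t k) * (t i - t0 i) * (\<Prod>k=i+1..<j. t0 k)) * t0 j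
        + (\<Prod>k=1..<j. t k) * (t j - t0 j)"
      using False by (simp add: sum_distrib_right mult.assoc)
    also have "\<dots> = (\<Prod>k=1..<Suc j. t k) - (\<Prod>k=1..<Suc j. t0 k)"
      unfolding Suc.IH[symmetric] using False by (simp add: algebra_simps)
    finally show ?thesis by simp
  qed simp
qed simp

section \<open>The cascade of factors\<close>

locale cascade =
  fixes m :: nat and a b c d tau l :: "nat \<Rightarrow> complex"
    and \<theta> f e :: "nat \<Rightarrow> complex \<times> complex \<Rightarrow> complex"
  assumes factor: "\<And>i. i \<in> {1..m} \<Longrightarrow> factor11 (a i) (b i) (c i) (d i) (l i)"
    and l_nonzero: "\<And>i. i \<in> {1..m} \<Longrightarrow> l i \<noteq> 0"
    and l_tau: "\<And>i. i \<in> {1..m} \<Longrightarrow> l i * tau i = - cnj (l i)"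
    and \<theta>_eq: "\<And>i. \<theta> i = (\<lambda>z. poly11_refl (a i) (b i) (c i) (d i) z / poly11 (a i) (b i) (c i) (d i) z)"
    and f_eq: "\<And>i. f i = (\<lambda>z. l i * (snd z - tau i) / poly11 (a i) (b i) (c i) (d i) z)"
    and e_eq: "\<And>j. e j = (\<lambda>z. (\<Prod>k=1..<j. \<theta> k z) * f j z)"
begin

definition S :: "nat \<Rightarrow> complex \<Rightarrow> complex" where
  "S i w = l i * ((w - tau i) / (a i + c i * w))"

definition \<theta>0 :: "nat \<Rightarrow> complex \<Rightarrow> complex" where
  "\<theta>0 i w = (cnj (b i) * w + cnj (d i)) / (a i + c i * w)"

text \<open>Since \<open>p = A (1 - \<phi> z1)\<close> with \<open>A = a + c w\<close>, the function
  \<open>f\<close> is the sum of the geometric series with first term \<open>S\<close> and ratio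
  \<open>\<phi> z1\<close>.\<close>

definition \<phi> :: "nat \<Rightarrow> complex \<Rightarrow> complex" where
  "\<phi> i w = - ((b i + d i * w) / (a i + c i * w))"

definition hfun :: "nat \<Rightarrow> nat \<Rightarrow> complex \<Rightarrow> complex" where
  "hfun i j w = (if i < j then S j w * S i w * (\<Prod>k=i+1..<j. \<theta>0 k w)
     else if i = j then \<phi> i w else 0)"

text \<open>\<open>hfun\<close> cut off outside the open disc and outside the index range, as the
  normalisation in \<open>MTheta_h\<close> demands.\<close>

definition hmat :: "nat \<Rightarrow> nat \<Rightarrow> complex \<Rightarrow> complex" where
  "hmat i j w = (if i \<in> {1..m} \<and> j \<in> {1..m} \<and> norm w < 1 then hfun i j w else 0)"

lemma l_diff: "i \<in> {1..m} \<Longrightarrow> l i * (w - tau i) = cnj (l i) + l i * w"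
  using l_tau[of i] by (simp add: right_diff_distrib)

lemma poly11_split: "poly11 (a i) (b i) (c i) (d i) (x, w) = (a i + c i * w) + (b i + d i * w) * x"
  by (simp add: poly11_def algebra_simps)

lemma A_nz: "i \<in> {1..m} \<Longrightarrow> norm w < 1 \<Longrightarrow> a i + c i * w \<noteq> 0"
  using factor11.A_nonzero[OF factor] by simp

lemma p_nz: "i \<in> {1..m} \<Longrightarrow> norm x < 1 \<Longrightarrow> norm w < 1 \<Longrightarrow> poly11 (a i) (b i) (c i) (d i) (x, w) \<noteq> 0"
  unfolding poly11_split by (rule factor11.p_nonzero[OF factor])

text \<open>The system response to zero input and constant initial state 1.\<close>

lemma f_H2:
  assumes i: "i \<in> {1..m}"
  shows "f i \<in> H2"
proof -
  interpret factor11 "a i" "b i" "c i" "d i" "l i" by (rule factor[OF i])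
  have Z: "(\<lambda>z. 0) \<in> H2"
    unfolding H2_def has_H2_coeffs_def by (auto intro!: exI[of _ "\<lambda>_. 0"] simp: case_prod_unfold)
  show ?thesis
    using state_space_H2[OF Z disc_coeffs_one] unfolding f_eq l_diff[OF i] poly11_def by simp
qed

text \<open>The system response to input \<open>G\<close> with zero initial state.\<close>

lemma \<theta>_mult_H2:
  assumes i: "i \<in> {1..m}" and "G \<in> H2"
  shows "(\<lambda>z. \<theta> i z * G z) \<in> H2"
proof -
  interpret factor11 "a i" "b i" "c i" "d i" "l i" by (rule factor[OF i])
  have "disc_coeffs (\<lambda>w. 0) (\<lambda>n. 0)" by (simp add: disc_coeffs_def l2_def)
  from state_space_H2[OF assms(2) this] show ?thesis
    unfolding \<theta>_eq poly11_def poly11_refl_def by simp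
qed

lemma prod_\<theta>_mult_H2: "n \<le> Suc m \<Longrightarrow> G \<in> H2 \<Longrightarrow> (\<lambda>z. (\<Prod>k=1..<n. \<theta> k z) * G z) \<in> H2"
proof (induction n)
  case (Suc n)
  show ?case
  proof (cases "n = 0")
    case False
    then have "(\<lambda>z. \<theta> n z * ((\<Prod>k=1..<n. \<theta> k z) * G z)) \<in> H2"
      using Suc by (intro \<theta>_mult_H2) auto
    then show ?thesis using False by (simp add: mult_ac)
  qed (use Suc in simp)
qed simp

lemma e_H2: "j \<in> {1..m} \<Longrightarrow> e j \<in> H2"
  unfolding e_eq by (intro prod_\<theta>_mult_H2 f_H2) auto

text \<open>Over a common denominator the numerator is \<open>x\<close> times the expression in
  \<open>determinant\<close>, hence \<open>x * s^2\<close>; one factor \<open>s\<close> goes to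
  \<open>f\<close>, the other to \<open>S\<close>.\<close>

lemma \<theta>_diff:
  assumes i: "i \<in> {1..m}" and x: "norm x < 1" and w: "norm w < 1"
  shows "\<theta> i (x, w) - \<theta>0 i w = x * (f i (x, w) * S i w)"
proof -
  define A B s where "A = a i + c i * w" and "B = b i + d i * w" and "s = l i * (w - tau i)"
  have A: "A \<noteq> 0" using A_nz[OF i w] by (simp add: A_def)
  have p: "A + B * x \<noteq> 0" using p_nz[OF i x w] by (simp add: A_def B_def poly11_split)
  have det: "(cnj (a i) * w + cnj (c i)) * A - B * (cnj (b i) * w + cnj (d i)) = s\<^sup>2"
    using factor11.determinant[OF factor[OF i], of w] by (simp add: A_def B_def s_def l_diff[OF i])
  have "\<theta> i (x, w) - \<theta>0 i w = ((cnj (a i) * w + cnj (c i)) * x + (cnj (b i) * w + cnj (d i))) / (A + B * x)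
      - (cnj (b i) * w + cnj (d i)) / A"
    unfolding \<theta>_eq \<theta>0_def poly11_split by (simp add: A_def B_def poly11_refl_def algebra_simps)
  also have "\<dots> = x * ((cnj (a i) * w + cnj (c i)) * A - B * (cnj (b i) * w + cnj (d i))) / ((A + B * x) * A)"
    using A p by (simp add: divide_simps) (simp add: algebra_simps)
  also have "\<dots> = x * (f i (x, w) * S i w)"
    unfolding det f_eq S_def poly11_split by (simp add: A_def B_def s_def power2_eq_square)
  finally show ?thesis .
qed

lemma f_diff:
  assumes i: "i \<in> {1..m}" and x: "norm x < 1" and w: "norm w < 1"
  shows "f i (x, w) = S i w + x * (f i (x, w) * \<phi> i w)"
proof -
  define A B s where "A = a i + c i * w" and "B = b i + d i * w" and "s = l i * (w - tau i)"
  have A: "A \<noteq> 0" using A_nz[OF i w] by (simp add: A_def)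
  have p: "A + B * x \<noteq> 0" using p_nz[OF i x w] by (simp add: A_def B_def poly11_split)
  have key: "s / (A + B * x) = s / A + x * (s / (A + B * x) * (- (B / A)))"
    using A p by (simp add: divide_simps) (simp add: algebra_simps)
  have eqs: "f i (x, w) = s / (A + B * x)" "S i w = s / A" "\<phi> i w = - (B / A)"
    by (simp_all add: f_eq S_def \<phi>_def poly11_split A_def B_def s_def)
  show ?thesis unfolding eqs by (rule key)
qed

lemma f_0: "f i (0, w) = S i w" and \<theta>_0: "\<theta> i (0, w) = \<theta>0 i w"
  by (simp_all add: f_eq S_def \<theta>_eq \<theta>0_def poly11_def poly11_refl_def)

text \<open>The change of the product of the \<open>\<theta> k\<close> is telescoped: the summand at
  \<open>i\<close> has a prefix at \<open>x\<close> that combines with \<open>f i\<close> to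
  \<open>e i\<close>, and a suffix at 0 that enters \<open>hfun i j\<close>. The change of the last
  factor \<open>f j\<close> contributes the diagonal entry by \<open>f_diff\<close>.\<close>

lemma e_diff:
  assumes j: "j \<in> {1..m}" and x: "norm x < 1" and w: "norm w < 1"
  shows "e j (x, w) = e j (0, w) + x * (\<Sum>i=1..m. e i (x, w) * hmat i j w)"
proof -
  let ?P = "\<lambda>j. \<Prod>k=1..<j. \<theta> k (x, w)" and ?Q = "\<Prod>k=1..<j. \<theta>0 k w"
  have "(\<Sum>i=1..m. e i (x, w) * hmat i j w) = (\<Sum>i\<in>{1..<j} \<union> {j}. e i (x, w) * hmat i j w)"
    using j by (intro sum.mono_neutral_right) (auto simp: hmat_def hfun_def)
  also have "\<dots> = (\<Sum>i=1..<j. e i (x, w) * hmat i j w) + e j (x, w) * \<phi> j w"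
    using j w by (subst sum.union_disjoint) (auto simp: hmat_def hfun_def)
  also have "(\<Sum>i=1..<j. e i (x, w) * hmat i j w)
      = (\<Sum>i=1..<j. S j w * (?P i * (f i (x, w) * S i w) * (\<Prod>k=i+1..<j. \<theta>0 k w)))"
    using j w by (intro sum.cong) (auto simp: hmat_def hfun_def e_eq)
  finally have "x * (\<Sum>i=1..m. e i (x, w) * hmat i j w)
      = S j w * (\<Sum>i=1..<j. ?P i * (x * (f i (x, w) * S i w)) * (\<Prod>k=i+1..<j. \<theta>0 k w)) + x * e j (x, w) * \<phi> j w"
    by (simp add: sum_distrib_left distrib_left mult_ac)
  also have "(\<Sum>i=1..<j. ?P i * (x * (f i (x, w) * S i w)) * (\<Prod>k=i+1..<j. \<theta>0 k w))
      = (\<Sum>i=1..<j. ?P i * (\<theta> i (x, w) - \<theta>0 i w) * (\<Prod>k=i+1..<j. \<theta>0 k w))"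
    using j by (intro sum.cong refl) (auto simp: \<theta>_diff[OF _ x w])
  also have "\<dots> = ?P j - ?Q" by (rule prod_diff_telescope[symmetric])
  finally have "x * (\<Sum>i=1..m. e i (x, w) * hmat i j w) = S j w * (?P j - ?Q) + x * e j (x, w) * \<phi> j w" .
  moreover have "e j (x, w) = ?P j * (S j w + x * (f j (x, w) * \<phi> j w))"
    unfolding f_diff[OF j x w, symmetric] by (simp add: e_eq)
  moreover have "e j (0, w) = ?Q * S j w" by (simp add: e_eq f_0 \<theta>_0)
  moreover have "x * e j (x, w) * \<phi> j w = ?P j * (x * (f j (x, w) * \<phi> j w))" by (simp add: e_eq)
  ultimately show ?thesis by (simp add: algebra_simps)
qed

lemma disc_coeffs_mobius_mult:
  assumes "i \<in> {1..m}" "\<exists>u. disc_coeffs g u"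
  shows "\<exists>u. disc_coeffs (\<lambda>w. (\<alpha> + \<beta> * w) / (a i + c i * w) * g w) u"
proof -
  obtain u where "disc_coeffs g u" using assms(2) by blast
  from disc_coeffs_divlin[OF factor11.ca[OF factor[OF assms(1)]] disc_coeffs_lin[OF this, of \<alpha> \<beta>]]
  show ?thesis by auto
qed

text \<open>Every nonzero entry is a product of factors
  \<open>(\<alpha> + \<beta> w) / (a k + c k * w)\<close>, and multiplication by each of them
  preserves square summability because \<open>\<bar>c k\<bar> < \<bar>a k\<bar>\<close>.\<close>

lemma hfun_disc_coeffs:
  assumes i: "i \<in> {1..m}" and j: "j \<in> {1..m}"
  shows "\<exists>u. disc_coeffs (hfun i j) u"
proof -
  have one: "\<exists>u. disc_coeffs (\<lambda>w. 1) u" using disc_coeffs_one by blast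
  have S: "S k w = (cnj (l k) + l k * w) / (a k + c k * w)" if "k \<in> {1..m}" for k w
    by (simp add: S_def flip: l_diff[OF that])
  have prod: "\<exists>u. disc_coeffs (\<lambda>w. \<Prod>k=i+1..<n. \<theta>0 k w) u" if "n \<le> m" for n
    using that
  proof (induction n)
    case (Suc n)
    show ?case
    proof (cases "n \<ge> i + 1")
      case True
      have "\<exists>u. disc_coeffs (\<lambda>w. (cnj (d n) + cnj (b n) * w) / (a n + c n * w) * (\<Prod>k=i+1..<n. \<theta>0 k w)) u"
        using Suc True i by (intro disc_coeffs_mobius_mult) auto
      moreover have "(\<Prod>k=i+1..<Suc n. \<theta>0 k w)
          = (cnj (d n) + cnj (b n) * w) / (a n + c n * w) * (\<Prod>k=i+1..<n. \<theta>0 k w)" for w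
        using True by (simp add: \<theta>0_def add.commute mult.commute)
      ultimately show ?thesis by simp
    qed (use one in simp)
  qed (use one in simp)
  consider "i < j" | "i = j" | "j < i" by linarith
  then show ?thesis
  proof cases
    case 1
    have "\<exists>u. disc_coeffs (\<lambda>w. (cnj (l j) + l j * w) / (a j + c j * w) *
        ((cnj (l i) + l i * w) / (a i + c i * w) * (\<Prod>k=i+1..<j. \<theta>0 k w))) u"
      using j by (intro disc_coeffs_mobius_mult i j prod) auto
    moreover have "hfun i j = (\<lambda>w. (cnj (l j) + l j * w) / (a j + c j * w) *
        ((cnj (l i) + l i * w) / (a i + c i * w) * (\<Prod>k=i+1..<j. \<theta>0 k w)))"
      unfolding hfun_def S[OF i] S[OF j] using 1 by (simp add: fun_eq_iff)
    ultimately show ?thesis by simp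
  next
    case 2
    have "\<exists>u. disc_coeffs (\<lambda>w. (- b i + - d i * w) / (a i + c i * w) * 1) u"
      by (intro disc_coeffs_mobius_mult i one)
    moreover have "hfun i j = (\<lambda>w. (- b i + - d i * w) / (a i + c i * w) * 1)"
      unfolding hfun_def using 2 by (simp add: fun_eq_iff \<phi>_def minus_divide_left)
    ultimately show ?thesis by simp
  next
    case 3
    have "hfun i j = (\<lambda>w. 0)" unfolding hfun_def using 3 by (simp add: fun_eq_iff)
    then show ?thesis by (auto simp: disc_coeffs_def l2_def intro!: exI[of _ "\<lambda>_. 0"])
  qed
qed

lemma hmat_H2_disc: "hmat i j \<in> H2_disc"
proof (cases "i \<in> {1..m} \<and> j \<in> {1..m}")
  case True
  then obtain u where "disc_coeffs (hfun i j) u" using hfun_disc_coeffs by blast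
  with True show ?thesis
    unfolding H2_disc_def disc_coeffs_def l2_def by (auto intro!: exI[of _ u] simp: hmat_def)
next
  case False
  then show ?thesis
    unfolding H2_disc_def by (auto intro!: exI[of _ "\<lambda>_. 0"] simp: hmat_def)
qed

lemma hmat_adjoint:
  assumes j: "j \<in> {1..m}"
  shows "Mz1_adjoint_is (e j) (\<lambda>z. \<Sum>i=1..m. e i z * hmat i j (snd z))"
proof (rule Mz1_adjoint_isI[OF e_H2[OF j]])
  show "e j (x, w) = e j (0, w) + x * (\<Sum>i=1..m. e i (x, w) * hmat i j (snd (x, w)))"
    if "norm x < 1" "norm w < 1" for x w
    using e_diff[OF j that] by simp
  show "((\<lambda>x. \<Sum>i=1..m. e i (x, w) * hmat i j (snd (x, w))) \<longlongrightarrow>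
      (\<Sum>i=1..m. e i (0, w) * hmat i j (snd (0, w)))) (at 0)" if "norm w < 1" for w
    unfolding snd_conv by (intro tendsto_intros H2_tendsto_fst_0 e_H2 that)
qed

section \<open>Uniqueness of the matrix function\<close>

lemma e_independent:
  assumes w: "norm w < 1"
    and zero: "\<And>k. k \<in> {1..m} \<Longrightarrow> norm (cnj (b k) * w + cnj (d k)) < norm (cnj (a k) * w + cnj (c k))"
    and tau: "\<And>k. k \<in> {1..m} \<Longrightarrow> w \<noteq> tau k"
    and comb: "\<And>x. norm x < 1 \<Longrightarrow> (\<Sum>i=1..m. e i (x, w) * g i) = 0"
    and i: "i \<in> {1..m}"
  shows "g i = 0"
proof -
  \<comment> \<open>\<open>cascade_independent\<close> counts from 0, so all families are shifted by
    one.\<close>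
  have "g (Suc (i - 1)) = 0"
  proof (rule cascade_independent[where T = "\<lambda>k x. \<theta> (Suc k) (x, w)" and F = "\<lambda>k x. f (Suc k) (x, w)"
        and g = "\<lambda>k. g (Suc k)" and n = m])
    show "i - 1 < m" using i by auto
    fix k assume "k < m"
    then have k: "Suc k \<in> {1..m}" by auto
    have p: "a (Suc k) + b (Suc k) * x + c (Suc k) * w + d (Suc k) * x * w \<noteq> 0" if "x \<in> ball 0 1" for x
      using p_nz[OF k _ w, of x] that by (simp add: poly11_def)
    show "continuous_on (ball 0 1) (\<lambda>x. \<theta> (Suc k) (x, w))"
      unfolding \<theta>_eq poly11_refl_def poly11_def fst_conv snd_conv
      by (intro continuous_intros) (use p in auto)
    show "continuous_on (ball 0 1) (\<lambda>x. f (Suc k) (x, w))"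
      unfolding f_eq poly11_def fst_conv snd_conv
      by (intro continuous_intros) (use p in auto)
    show "f (Suc k) (x, w) \<noteq> 0" if "x \<in> ball 0 1" for x
      using p[OF that] l_nonzero[OF k] tau[OF k] by (simp add: f_eq poly11_def)
    define A B where "A = cnj (a (Suc k)) * w + cnj (c (Suc k))" and "B = cnj (b (Suc k)) * w + cnj (d (Suc k))"
    have AB: "norm B < norm A" using zero[OF k] by (simp add: A_def B_def)
    then have A: "A \<noteq> 0" by auto
    have \<theta>0_iff: "\<theta> (Suc k) (x, w) = 0 \<longleftrightarrow> x = - B / A" if "x \<in> ball 0 1" for x
    proof -
      have "poly11_refl (a (Suc k)) (b (Suc k)) (c (Suc k)) (d (Suc k)) (x, w) = A * x + B"
        by (simp add: poly11_refl_def A_def B_def algebra_simps)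
      then have "\<theta> (Suc k) (x, w) = 0 \<longleftrightarrow> A * x + B = 0"
        using p[OF that] by (simp add: \<theta>_eq poly11_def)
      also have "\<dots> \<longleftrightarrow> x = - B / A"
        using A by (auto simp: field_simps add_eq_0_iff)
      finally show ?thesis .
    qed
    have "- B / A \<in> ball 0 1" using AB A by (simp add: norm_divide)
    then show "\<exists>\<zeta>\<in>ball 0 1. \<theta> (Suc k) (\<zeta>, w) = 0 \<and> (\<forall>z\<in>ball 0 1. z \<noteq> \<zeta> \<longrightarrow> \<theta> (Suc k) (z, w) \<noteq> 0)"
      using \<theta>0_iff by blast
  next
    fix x :: complex assume "x \<in> ball 0 1"
    then have "(\<Sum>i=1..m. e i (x, w) * g i) = 0" by (intro comb) simp
    moreover have "(\<Sum>i=1..m. e i (x, w) * g i) = (\<Sum>j<m. e (Suc j) (x, w) * g (Suc j))"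
      by (simp only: One_nat_def sum.atLeast1_atMost_eq)
    moreover have "(\<Prod>k=1..<Suc j. \<theta> k (x, w)) = (\<Prod>k<j. \<theta> (Suc k) (x, w))" for j
      by (simp only: One_nat_def prod.shift_bounds_Suc_ivl lessThan_atLeast0)
    ultimately show "(\<Sum>j<m. (\<Prod>k<j. \<theta> (Suc k) (x, w)) * f (Suc j) (x, w) * g (Suc j)) = 0"
      by (simp add: e_eq)
  qed
  then show ?thesis using i by simp
qed

text \<open>The conditions hold at any point of the circle other than the \<open>tau k\<close>, and
  they are open, so they persist in a neighbourhood, which meets the disc.\<close>

lemma good_open_set:
  obtains V where "open V" "V \<inter> ball 0 1 \<noteq> {}"
    "\<forall>w\<in>V. \<forall>k\<in>{1..m}. norm (cnj (b k) * w + cnj (d k)) < norm (cnj (a k) * w + cnj (c k)) \<and> w \<noteq> tau k"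
proof -
  \<comment> \<open>A connected set with two points is infinite, so the circle is not exhausted by
    the finitely many \<open>tau k\<close>.\<close>
  have "connected (sphere (0::complex) 1)" by (rule connected_sphere) simp
  moreover have "1 \<in> sphere (0::complex) 1" "- 1 \<in> sphere (0::complex) 1" by simp_all
  moreover have "(1::complex) \<noteq> - 1" by simp
  ultimately have "infinite (sphere (0::complex) 1)"
    by (metis connected_finite_iff_sing empty_iff singletonD)
  then obtain w0 where w0: "norm w0 = 1" "w0 \<notin> tau ` {1..m}"
    by (metis finite_atLeastAtMost finite_imageI mem_sphere_0 rev_finite_subset subsetI)
  define V where "V = (\<Inter>k\<in>{1..m}. {w. norm (cnj (b k) * w + cnj (d k)) < norm (cnj (a k) * w + cnj (c k))} \<inter> - {tau k})"
  have V: "open V" unfolding V_def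
    by (intro open_INT ballI open_Int open_Collect_less continuous_intros) auto
  have "norm (cnj (b k) * w0 + cnj (d k)) < norm (cnj (a k) * w0 + cnj (c k))" if k: "k \<in> {1..m}" for k
  proof (rule factor11.zero_in_disc_on_circle[OF factor[OF k] w0(1)])
    have "w0 \<noteq> tau k" using w0(2) k by auto
    then show "cnj (l k) + l k * w0 \<noteq> 0"
      unfolding l_diff[OF k, symmetric] using l_nonzero[OF k] by simp
  qed
  then have "w0 \<in> V" using w0(2) by (auto simp: V_def)
  moreover have "w0 \<in> closure (ball 0 1)" using w0(1) by simp
  ultimately have "V \<inter> ball 0 1 \<noteq> {}" using V open_Int_closure_eq_empty by blast
  with V show ?thesis by (rule that) (auto simp: V_def)
qed

text \<open>A competitor \<open>H\<close> gives the same adjoint on the bidisk, so for fixed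
  \<open>v\<close> the differences of entries annihilate the \<open>e i\<close>. Independence makes
  them vanish near part of the circle.\<close>

lemma MTheta_h_eq: "MTheta_h m e = hmat"
  unfolding MTheta_h_def
proof (rule the_equality)
  show "(\<forall>i j. hmat i j \<in> H2_disc) \<and>
      (\<forall>i j. i \<notin> {1..m} \<or> j \<notin> {1..m} \<longrightarrow> hmat i j = (\<lambda>_. 0)) \<and>
      (\<forall>j\<in>{1..m}. Mz1_adjoint_is (e j) (\<lambda>z. \<Sum>i=1..m. e i z * hmat i j (snd z)))"
    using hmat_H2_disc hmat_adjoint by (auto simp: hmat_def fun_eq_iff)
next
  fix H
  assume "(\<forall>i j. H i j \<in> H2_disc) \<and>
      (\<forall>i j. i \<notin> {1..m} \<or> j \<notin> {1..m} \<longrightarrow> H i j = (\<lambda>_. 0)) \<and>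
      (\<forall>j\<in>{1..m}. Mz1_adjoint_is (e j) (\<lambda>z. \<Sum>i=1..m. e i z * H i j (snd z)))"
  then have H1: "\<And>i j. H i j \<in> H2_disc"
    and H2: "\<And>i j. i \<notin> {1..m} \<or> j \<notin> {1..m} \<Longrightarrow> H i j = (\<lambda>_. 0)"
    and H3: "\<And>j. j \<in> {1..m} \<Longrightarrow> Mz1_adjoint_is (e j) (\<lambda>z. \<Sum>i=1..m. e i z * H i j (snd z))"
    by auto
  obtain V where V: "open V" "V \<inter> ball 0 1 \<noteq> {}"
    "\<forall>w\<in>V. \<forall>k\<in>{1..m}. norm (cnj (b k) * w + cnj (d k)) < norm (cnj (a k) * w + cnj (c k)) \<and> w \<noteq> tau k"
    by (rule good_open_set)
  have "H i j w = hmat i j w" for i j w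
  proof (cases "i \<in> {1..m} \<and> j \<in> {1..m} \<and> norm w < 1")
    case True
    then have i: "i \<in> {1..m}" and j: "j \<in> {1..m}" and w: "norm w < 1" by auto
    have onV: "H i j v = hmat i j v" if v: "v \<in> V \<inter> ball 0 1" for v
    proof -
      have v1: "norm v < 1" using v by simp
      have comb: "(\<Sum>i=1..m. e i (x, v) * (H i j v - hmat i j v)) = 0" if "norm x < 1" for x
        using Mz1_adjoint_unique[OF H3[OF j] hmat_adjoint[OF j], of "(x, v)"] that v1
        by (simp add: bidisk_def right_diff_distrib sum_subtractf)
      have "H i j v - hmat i j v = 0"
        by (rule e_independent[OF v1 _ _ comb i]) (use V(3) v in auto)
      then show ?thesis by simp
    qed
    show ?thesis
      \<comment> \<open>Both entries are holomorphic on the disc and agree on a nonempty open subset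
        of it.\<close>
      by (rule analytic_continuation_open[of "V \<inter> ball 0 1" "ball 0 1" "H i j" "hmat i j"])
        (use V w H1 hmat_H2_disc H2_disc_holomorphic onV in auto)
  next
    case False
    show ?thesis
    proof (cases "norm w < 1")
      case True
      with False have ij: "i \<notin> {1..m} \<or> j \<notin> {1..m}" by blast
      have "H i j w = 0" unfolding H2[OF ij] ..
      then show ?thesis using ij by (auto simp: hmat_def)
    next
      case False
      then show ?thesis using H1[of i j] by (simp add: H2_disc_def hmat_def)
    qed
  qed
  then show "H = hmat" by (simp add: fun_eq_iff)
qed

end

theorem theorem4p4:
  fixes m :: nat
    and a b c d :: "nat \<Rightarrow> complex"
    and tau1 tau2 :: "nat \<Rightarrow> complex"
    and lam :: "nat \<Rightarrow> complex"
    and \<theta> f e :: "nat \<Rightarrow> complex \<times> complex \<Rightarrow> complex"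
  assumes no_zeros: "\<forall>i\<in>{1..m}. \<forall>z\<in>bidisk. poly11 (a i) (b i) (c i) (d i) z \<noteq> 0"
    and theta_def: "\<forall>i. \<theta> i = (\<lambda>z. poly11_refl (a i) (b i) (c i) (d i) z / poly11 (a i) (b i) (c i) (d i) z)"
    and deg11: "\<forall>i\<in>{1..m}. rat_deg_11 (\<theta> i)"
    and torus_zero: "\<forall>i\<in>{1..m}. norm (tau1 i) = 1 \<and> norm (tau2 i) = 1 \<and>
                       poly11 (a i) (b i) (c i) (d i) (tau1 i, tau2 i) = 0"
    and lambda_sq: "\<forall>i\<in>{1..m}. (lam i)\<^sup>2 = cnj (a i) * c i - d i * cnj (b i)"
    and f_def: "\<forall>i. f i = (\<lambda>z. lam i * (snd z - tau2 i) / poly11 (a i) (b i) (c i) (d i) z)"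
    and e_def: "\<forall>j. e j = (\<lambda>z. (\<Prod>k=1..<j. \<theta> k z) * f j z)"
  shows "\<forall>z2. norm z2 < 1 \<longrightarrow> (\<forall>j\<in>{1..m}. \<forall>i\<in>{1..m}.
           MTheta m e z2 j i =
             (if j > i then
                cnj (lam j * ((z2 - tau2 j) / (a j + c j * z2)) *
                     (lam i * ((z2 - tau2 i) / (a i + c i * z2))) *
                     (\<Prod>k=i+1..<j. (cnj (b k) * z2 + cnj (d k)) / (a k + c k * z2)))
              else if j = i then
                cnj (- ((b i + d i * z2) / (a i + c i * z2)))
              else 0))"
proof -
  have F: "factor11 (a i) (b i) (c i) (d i) (lam i)" "lam i \<noteq> 0" "lam i * tau2 i = - cnj (lam i)"
    if i: "i \<in> {1..m}" for i
  proof -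
    have "rat_deg_11 (\<lambda>z. poly11_refl (a i) (b i) (c i) (d i) z / poly11 (a i) (b i) (c i) (d i) z)"
      using deg11 theta_def i by metis
    then show "factor11 (a i) (b i) (c i) (d i) (lam i)" "lam i \<noteq> 0" "lam i * tau2 i = - cnj (lam i)"
      using factor11_of_torus_zero[of "a i" "b i" "c i" "d i" "tau1 i" "tau2 i" "lam i"]
        no_zeros torus_zero lambda_sq i by auto
  qed
  interpret cascade m a b c d tau2 lam \<theta> f e
    by (rule cascade.intro; use F theta_def f_def e_def in blast)
  \<comment> \<open>\<open>MTheta m e z2 j i\<close> conjugates the entry with indices
    \<open>i j\<close>, so the case \<open>j > i\<close> comes from the branch \<open>i < j\<close>
    of \<open>hfun\<close>.\<close>
  show ?thesis
    by (auto simp: MTheta_def MTheta_h_eq hmat_def hfun_def S_def \<theta>0_def \<phi>_def)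
qed

end
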